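(* Let $B\subseteq\mathbb{R}$ be an $F_\sigma$ additive subgroup, and let $D\subseteq\mathbb{R}\setminus\mathbb{Q}$ be countable. There is an $F_\sigma$ set $A\subseteq\mathbb{R}$ that is a $\mathbb{Q}$-vector subspace of $\mathbb{R}$ such that $$B\subseteq A,\qquad \dim_{\mathrm H} A=\dim_{\mathrm H} B,\qquad D\subseteq X_A.$$ In particular, for every $d\in[0,1)$ and every countable $D\subseteq\mathbb{R}\setminus\mathbb{Q}$, there is an $F_\sigma$ $\mathbb{Q}$-vector subspace $A\subseteq\mathbb{R}$ with $\dim_{\mathrm H} A=d$ and $D\subseteq X_A$.
   Context: $\dim_{\mathrm H}$ denotes Hausdorff dimension with respect to the Euclidean metric. For an additive subgroup $A$ of $\mathbb{R}$ and $\xi\in\mathbb{R}$, $A+\xi A=\{a+\xi b: a,b\in A\}$ and $X_A=\{\xi\in\mathbb{R}: A+\xi A=\mathbb{R}\}$. $F_\sigma$ means a countable union of closed subsets of $\mathbb{R}$. Countable sets may be finite or empty. *)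

theory Defs
  imports "HOL-Analysis.Analysis"
begin

section \<open>Hausdorff dimension\<close>

text \<open>
  The conventions at \<open>s = 0\<close> are \<open>|{}|^0 = 0\<close> and \<open>|U|^0 = 1\<close> for nonempty \<open>U\<close> (while
  \<^term>\<open>(0::real) powr 0 = 0\<close>), so that the \<open>0\<close>-dimensional measure is counting measure.
\<close>

definition diam_power :: "real \<Rightarrow> 'a::metric_space set \<Rightarrow> ennreal" where
  "diam_power s U =
     (if U = {} then 0 else if s = 0 then 1 else ennreal (diameter U powr s))"

text \<open>
  Boundedness is required explicitly because \<^const>\<open>diameter\<close> is real-valued and
  unspecified on unbounded sets. Finite covers are included by padding with \<open>{}\<close>.
\<close>

definition delta_covers :: "real \<Rightarrow> 'a::metric_space set \<Rightarrow> (nat \<Rightarrow> 'a set) set" where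
  "delta_covers \<delta> E =
     {U. E \<subseteq> (\<Union>i. U i) \<and> (\<forall>i. bounded (U i) \<and> diameter (U i) \<le> \<delta>)}"

definition hausdorff_premeasure :: "real \<Rightarrow> real \<Rightarrow> 'a::metric_space set \<Rightarrow> ennreal" where
  "hausdorff_premeasure s \<delta> E = (INF U\<in>delta_covers \<delta> E. \<Sum>i. diam_power s (U i))"

definition hausdorff_measure :: "real \<Rightarrow> 'a::metric_space set \<Rightarrow> ennreal" where
  "hausdorff_measure s E = (SUP \<delta>\<in>{0<..}. hausdorff_premeasure s \<delta> E)"

definition hausdorff_dim :: "'a::metric_space set \<Rightarrow> ennreal" where
  "hausdorff_dim E = Inf {ennreal s | s. 0 \<le> s \<and> hausdorff_measure s E = 0}"


section \<open>Additive subgroups and rational subspaces of the real line\<close>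

definition add_subgroup :: "'a::ab_group_add set \<Rightarrow> bool" where
  "add_subgroup A \<longleftrightarrow>
     0 \<in> A \<and> (\<forall>x\<in>A. \<forall>y\<in>A. x + y \<in> A) \<and> (\<forall>x\<in>A. - x \<in> A)"

text \<open>
  The reals as a vector space over the rationals; \<open>rat_real.subspace\<close> is the library's
  notion of subspace for this scalar multiplication (the plain \<^const>\<open>subspace\<close> is the one
  over the reals).
\<close>

global_interpretation rat_real: vector_space "\<lambda>(q::rat) (x::real). of_rat q * x"
  by unfold_locales (simp_all add: algebra_simps of_rat_add of_rat_mult)

definition X_set :: "real set \<Rightarrow> real set" where
  "X_set A = {\<xi>. {a + \<xi> * b | a b. a \<in> A \<and> b \<in> A} = UNIV}"

end

theory Submission
  imports Defs
begin

text \<open>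
  Fix irrational numbers \<open>\<xi> j\<close> and a subgroup \<open>B\<close> of dimension \<open>d\<close>. Read a real number \<open>t\<close> in the
  unit interval through its mixed radix digits: \<open>t\<close> is the sum of \<open>u k / R (k+1)\<close>, where
  \<open>R (k+1)\<close> is the product of the radices \<open>M 0, ..., M k\<close>. Each block \<open>u k\<close> is split between two numbers
  \<open>a\<close> and \<open>b\<close>, in proportions \<open>c k\<close> and \<open>e k\<close> with \<open>c k + \<xi> j * e k = 1\<close>; then \<open>a + \<xi> j * b = t\<close>
  whatever the proportions are. The set \<open>A\<close> is the rational span of \<open>B\<close> and all these numbers \<open>a\<close>, \<open>b\<close>.
  The freedom in the proportions is used to keep \<open>A\<close> small. For rational \<open>n\<close>, \<open>m\<close>, not both \<open>0\<close>, the
  direction \<open>(c k, e k)\<close> can be taken proportional to \<open>(m, -n)\<close>, precisely because \<open>\<xi> j\<close> is irrational, and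
  then the whole \<open>k\<close>-th block disappears from \<open>n * a + m * b\<close>.

  An element of the span combines finitely many pairs \<open>(a, b)\<close>, coming from different digit sequences and
  different \<open>\<xi> j\<close>, and all its terms have to lose the same block. So the direction at stage \<open>k\<close> is a function
  of \<open>j\<close> and of a prefix of the digit sequence, and it is read from a finite table. There are countably
  many tables, and each is used at infinitely many stages. Distinct digit sequences are told apart by a long
  enough prefix; hence every combination finds infinitely many stages at which it is, up to
  an error \<open>O(\<tau> k)\<close>, determined by the digits before \<open>k\<close>, so that it lies near one of \<open>R k ^ p\<close> points, \<open>p\<close>
  being the number of terms (\<open>piece_covered\<close>).

  The error \<open>\<tau> k\<close> is governed by the radix \<open>M k\<close>, which is chosen last. Given \<open>R k\<close>, first cover a compact part
  \<open>C k\<close> of \<open>B\<close> by finitely many balls so efficiently that multiplying the cover by \<open>R k ^ k\<close>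
  translates still costs little, then take \<open>\<tau> k\<close> below all radii of the cover, then \<open>M k\<close> so large that the later
  digits contribute at most \<open>\<tau> k\<close> (\<open>adapted_scales\<close>). Adding a combination to \<open>C k\<close> therefore only
  multiplies the cover by \<open>R k ^ p\<close> and its radii by a constant, and the dimension of \<open>A\<close> does not exceed that of
  \<open>B\<close> (\<open>hausdorff_null_piece\<close>, \<open>subspace_extension\<close>). The set \<open>A\<close> is a countable union of compact sets since the
  numbers \<open>a\<close>, \<open>b\<close> depend continuously on digit sequences from a compact space.

  For the second assertion a subgroup of given dimension \<open>d\<close> strictly between \<open>0\<close> and \<open>1\<close> is needed. It is generated by the numbers
  whose digits occupy widely separated blocks, each filling up the fraction \<open>d\<close> of its scale range. Reading the
  same digits without gaps is a Hoelder map of exponent \<open>d\<close> onto the unit interval (\<open>y_hoelder_x\<close>), which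
  bounds the dimension from below. At the end of a block, the sums of a fixed number of
  such numbers lie near few points, because the last block of a sum still lies in a short piece of a
  lattice (\<open>differences_near_grid\<close>); this bounds the dimension from above.
\<close>

section \<open>Hausdorff-null sets of reals\<close>

text \<open>
  For \<open>t > 0\<close> these are the sets of vanishing \<open>t\<close>-dimensional measure. Balls of positive radius replace arbitrary
  sets because they are open, which gives finite covers of compact sets, and because they behave well under
  translation and scaling. A small sum forces all radii to be small, so no bound on the diameters
  occurs.
\<close>

definition hausdorff_null :: "real \<Rightarrow> real set \<Rightarrow> bool" where
  "hausdorff_null t E \<longleftrightarrow> (\<forall>\<epsilon>>0. \<exists>(c::nat \<Rightarrow> real) r. (\<forall>i. 0 < r i) \<and> E \<subseteq> (\<Union>i. ball (c i) (r i)) \<and>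
     (\<Sum>i. ennreal (r i powr t)) < ennreal \<epsilon>)"

lemma suminf_geometric_ennreal:
  assumes "0 \<le> \<epsilon>"
  shows "(\<Sum>i. ennreal (\<epsilon> * (1/2)^Suc i)) = ennreal \<epsilon>"
proof (rule suminf_ennreal_eq)
  show "(\<lambda>i. \<epsilon> * (1/2)^Suc i) sums \<epsilon>"
    using sums_mult[OF power_half_series, of \<epsilon>] by simp
qed (use assms in auto)

lemma powr_less_imp_less_root:
  fixes r t \<epsilon> :: real
  assumes "0 < t" "0 < r" "r powr t < \<epsilon>"
  shows "r < \<epsilon> powr (1/t)"
proof -
  have "(r powr t) powr (1/t) < \<epsilon> powr (1/t)"
    using assms by (intro powr_less_mono2) auto
  then show ?thesis using assms by (simp add: powr_powr)
qed

lemma suminf_ennreal_term_less: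
  assumes "(\<Sum>i. ennreal (f i)) < ennreal \<epsilon>"
  shows "f (i::nat) < \<epsilon>"
proof -
  have "ennreal (f i) \<le> (\<Sum>i. ennreal (f i))"
    using sum_le_suminf[of "\<lambda>i. ennreal (f i)" "{i}"] by auto
  then have "ennreal (f i) < ennreal \<epsilon>" using assms by (rule order_le_less_trans)
  then show ?thesis by (metis ennreal_leI not_le)
qed

lemma hausdorff_nullD:
  assumes "hausdorff_null t E" "0 < \<epsilon>"
  shows "\<exists>(c::nat \<Rightarrow> real) r. (\<forall>i. 0 < r i) \<and> E \<subseteq> (\<Union>i. ball (c i) (r i)) \<and>
     (\<Sum>i. ennreal (r i powr t)) < ennreal \<epsilon>"
  using assms by (simp add: hausdorff_null_def)

text \<open>
  Requiring the sum to be below \<open>\<delta> powr t\<close> makes each single radius smaller than \<open>\<delta>\<close>.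
\<close>

lemma hausdorff_nullE:
  assumes "hausdorff_null t E" "0 < t" "0 < \<epsilon>" "0 < \<delta>"
  obtains c r where "\<And>i::nat. 0 < r i" "\<And>i. r i < \<delta>" "E \<subseteq> (\<Union>i. ball (c i) (r i))"
    "(\<Sum>i. ennreal (r i powr t)) < ennreal \<epsilon>"
proof -
  have e: "0 < min \<epsilon> (\<delta> powr t)" using assms by simp
  obtain c r where *: "\<forall>i::nat. 0 < r i" "E \<subseteq> (\<Union>i. ball (c i) (r i))"
    "(\<Sum>i. ennreal (r i powr t)) < ennreal (min \<epsilon> (\<delta> powr t))"
    using hausdorff_nullD[OF assms(1) e] by blast
  have "r i < \<delta>" for i
  proof -
    have "r i powr t < \<delta> powr t" using suminf_ennreal_term_less[OF *(3), of i] by simp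
    then have "r i < (\<delta> powr t) powr (1/t)" using powr_less_imp_less_root * assms(2) by blast
    then show ?thesis using assms by (simp add: powr_powr)
  qed
  moreover have "(\<Sum>i. ennreal (r i powr t)) < ennreal \<epsilon>"
    using *(3) by (rule order_less_le_trans) (simp add: ennreal_leI)
  ultimately show ?thesis using that * by blast
qed

lemma hausdorff_null_subset: "hausdorff_null t E \<Longrightarrow> F \<subseteq> E \<Longrightarrow> hausdorff_null t F"
  unfolding hausdorff_null_def by (meson subset_trans)

text \<open>
  A finite cover becomes a sequence of balls by adding balls whose radii have geometrically decreasing \<open>t\<close>-th
  powers. The index type is arbitrary since the covers met below are indexed by products.
\<close>

lemma hausdorff_null_finite_cover:
  assumes t: "0 < t"
    and cov: "\<And>\<epsilon>. 0 < \<epsilon> \<Longrightarrow> \<exists>(I::'i set) c r. finite I \<and> (\<forall>i\<in>I. 0 < r i) \<and>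
      E \<subseteq> (\<Union>i\<in>I. ball (c i) (r i)) \<and> (\<Sum>i\<in>I. r i powr t) < \<epsilon>"
  shows "hausdorff_null t E"
  unfolding hausdorff_null_def
proof (intro allI impI)
  fix \<epsilon> :: real assume e: "0 < \<epsilon>"
  obtain I c r where I: "finite (I::'i set)" "\<forall>i\<in>I. 0 < r i" "E \<subseteq> (\<Union>i\<in>I. ball (c i) (r i))"
    "(\<Sum>i\<in>I. r i powr t) < \<epsilon>/2" using cov[of "\<epsilon>/2"] e by auto
  obtain h where h: "bij_betw h {..<card I} I"
    using ex_bij_betw_nat_finite[OF I(1)] by (auto simp: atLeast0LessThan)
  have hI: "h i \<in> I" if "i < card I" for i using h that by (auto simp: bij_betw_def)
  define r' where "r' i = (if i < card I then r (h i) else (\<epsilon>/2 * (1/2)^Suc i) powr (1/t))" for i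
  define c' where "c' i = c (h i)" for i
  have "E \<subseteq> (\<Union>i. ball (c' i) (r' i))"
  proof
    fix x assume "x \<in> E"
    then obtain i where i: "i \<in> I" "x \<in> ball (c i) (r i)" using I(3) by blast
    then obtain j where "j < card I" "i = h j" using h by (auto simp: bij_betw_def)
    then have "x \<in> ball (c' j) (r' j)" using i by (simp add: c'_def r'_def)
    then show "x \<in> (\<Union>i. ball (c' i) (r' i))" by blast
  qed
  moreover have pos: "\<forall>i. 0 < r' i" using I(2) hI e by (simp add: r'_def)
  moreover have "(\<Sum>i. ennreal (r' i powr t)) < ennreal \<epsilon>"
  proof -
    define f where "f i = (if i < card I then r (h i) powr t else 0)" for i
    have le: "ennreal (r' i powr t) \<le> ennreal (f i) + ennreal (\<epsilon>/2 * (1/2)^Suc i)" for i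
      using t e by (auto simp: r'_def f_def powr_powr)
    have "(\<Sum>i. ennreal (r' i powr t)) \<le> (\<Sum>i. ennreal (f i) + ennreal (\<epsilon>/2 * (1/2)^Suc i))"
      by (intro suminf_le le) auto
    also have "\<dots> = (\<Sum>i. ennreal (f i)) + (\<Sum>i. ennreal (\<epsilon>/2 * (1/2)^Suc i))"
      by (rule suminf_add[symmetric]) auto
    also have "(\<Sum>i. ennreal (\<epsilon>/2 * (1/2)^Suc i)) = ennreal (\<epsilon>/2)"
      using e by (intro suminf_geometric_ennreal) auto
    also have "(\<Sum>i. ennreal (f i)) = (\<Sum>i<card I. ennreal (f i))"
      by (rule suminf_finite) (auto simp: f_def)
    also have "\<dots> = ennreal (\<Sum>i<card I. f i)" by (intro sum_ennreal) (simp add: f_def)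
    also have "(\<Sum>i<card I. f i) = (\<Sum>i<card I. r (h i) powr t)" by (simp add: f_def)
    also have "\<dots> = (\<Sum>i\<in>I. r i powr t)" by (rule sum.reindex_bij_betw[OF h])
    also have "ennreal (\<Sum>i\<in>I. r i powr t) + ennreal (\<epsilon>/2) = ennreal ((\<Sum>i\<in>I. r i powr t) + \<epsilon>/2)"
      using e by (intro ennreal_plus[symmetric] sum_nonneg) auto
    also have "\<dots> < ennreal \<epsilon>" using I(4) e by (intro ennreal_lessI) auto
    finally show ?thesis .
  qed
  ultimately show "\<exists>c r. (\<forall>i::nat. 0 < r i) \<and> E \<subseteq> (\<Union>i. ball (c i) (r i)) \<and>
     (\<Sum>i. ennreal (r i powr t)) < ennreal \<epsilon>" by blast
qed

lemma hausdorff_null_UN: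
  assumes "\<And>n::nat. hausdorff_null t (E n)"
  shows "hausdorff_null t (\<Union>n. E n)"
  unfolding hausdorff_null_def
proof (intro allI impI)
  fix \<epsilon> :: real assume e: "0 < \<epsilon>"
  have "\<forall>n. \<exists>(c::nat \<Rightarrow> real) r. (\<forall>i. 0 < r i) \<and> E n \<subseteq> (\<Union>i. ball (c i) (r i)) \<and>
     (\<Sum>i. ennreal (r i powr t)) < ennreal (\<epsilon>/2 * (1/2)^Suc n)"
    using hausdorff_nullD[OF assms] e by simp
  then obtain c r where cr: "\<And>n i::nat. 0 < (r n i :: real)" "\<And>n. E n \<subseteq> (\<Union>i. ball (c n i :: real) (r n i))"
    "\<And>n. (\<Sum>i. ennreal (r n i powr t)) < ennreal (\<epsilon>/2 * (1/2)^Suc n)" by metis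
  define c' where "c' k = (case prod_decode k of (n,i) \<Rightarrow> c n i)" for k
  define r' where "r' k = (case prod_decode k of (n,i) \<Rightarrow> r n i)" for k
  have "(\<Union>n. E n) \<subseteq> (\<Union>k. ball (c' k) (r' k))"
  proof
    fix x assume "x \<in> (\<Union>n. E n)"
    then obtain n i where "x \<in> ball (c n i) (r n i)" using cr(2) by blast
    then have "x \<in> ball (c' (prod_encode (n,i))) (r' (prod_encode (n,i)))"
      by (simp add: c'_def r'_def)
    then show "x \<in> (\<Union>k. ball (c' k) (r' k))" by blast
  qed
  moreover have "\<forall>k. 0 < r' k" using cr(1) by (simp add: r'_def split: prod.split)
  moreover have "(\<Sum>k. ennreal (r' k powr t)) < ennreal \<epsilon>"
  proof -
    have "(\<Sum>k. ennreal (r' k powr t)) = (\<Sum>k. ennreal (case prod_decode k of (n,i) \<Rightarrow> r n i powr t))"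
      unfolding r'_def by (intro suminf_cong) (simp add: split_def)
    also have "\<dots> = (\<Sum>n. (\<Sum>i. ennreal (r n i powr t)))"
      by (rule suminf_ennreal_2dimen[where f = "\<lambda>p. ennreal (case p of (n,i) \<Rightarrow> r n i powr t)"]) simp
    also have "\<dots> \<le> (\<Sum>n. ennreal (\<epsilon>/2 * (1/2)^Suc n))"
      using cr(3) by (intro suminf_le less_imp_le) auto
    also have "\<dots> = ennreal (\<epsilon>/2)" using e by (intro suminf_geometric_ennreal) auto
    also have "\<dots> < ennreal \<epsilon>" using e by (intro ennreal_lessI) auto
    finally show ?thesis .
  qed
  ultimately show "\<exists>c r. (\<forall>i::nat. 0 < r i) \<and> (\<Union>n. E n) \<subseteq> (\<Union>i. ball (c i) (r i)) \<and>
     (\<Sum>i. ennreal (r i powr t)) < ennreal \<epsilon>" by blast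
qed

lemma hausdorff_null_UN_countable:
  assumes "\<And>n::'i::countable. hausdorff_null t (E n)"
  shows "hausdorff_null t (\<Union>n. E n)"
proof -
  have "hausdorff_null t (\<Union>n. E (from_nat n))" using assms by (intro hausdorff_null_UN)
  moreover have "(\<Union>n. E n) \<subseteq> (\<Union>n. E (from_nat n))"
    by clarsimp (metis from_nat_to_nat)
  ultimately show ?thesis by (rule hausdorff_null_subset)
qed

lemma hausdorff_null_scale:
  assumes "hausdorff_null t E"
  shows "hausdorff_null t ((\<lambda>x. a * x) ` E)"
proof (cases "a = 0")
  case True
  show ?thesis unfolding hausdorff_null_def
  proof (intro allI impI)
    fix \<epsilon> :: real assume e: "0 < \<epsilon>"
    obtain c r where *: "\<forall>i::nat. 0 < r i" "E \<subseteq> (\<Union>i. ball (c i) (r i))"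
      "(\<Sum>i. ennreal (r i powr t)) < ennreal \<epsilon>"
      using hausdorff_nullD[OF assms e] by blast
    have "(\<lambda>x. a * x) ` E \<subseteq> (\<Union>i. ball 0 (r i))" using * True by auto
    then show "\<exists>c r. (\<forall>i::nat. 0 < r i) \<and> (\<lambda>x. a * x) ` E \<subseteq> (\<Union>i. ball (c i) (r i)) \<and>
      (\<Sum>i. ennreal (r i powr t)) < ennreal \<epsilon>" 
      by (intro exI[of _ "\<lambda>_. 0"] exI[of _ r]) (use * in auto)
  qed
next
  case False
  show ?thesis unfolding hausdorff_null_def
  proof (intro allI impI)
    fix \<epsilon> :: real assume e: "0 < \<epsilon>"
    have at: "0 < \<bar>a\<bar> powr t" using False by simp
    have "0 < \<epsilon> / \<bar>a\<bar> powr t" using e at by simp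
    then obtain c r where *: "\<forall>i::nat. 0 < r i" "E \<subseteq> (\<Union>i. ball (c i) (r i))"
      "(\<Sum>i. ennreal (r i powr t)) < ennreal (\<epsilon> / \<bar>a\<bar> powr t)"
      using hausdorff_nullD[OF assms] by blast
    have "(\<lambda>x. a * x) ` E \<subseteq> (\<Union>i. ball (a * c i) (\<bar>a\<bar> * r i))"
    proof
      fix y assume "y \<in> (\<lambda>x. a * x) ` E"
      then obtain x i where "y = a * x" "dist (c i) x < r i" using *(2) by fastforce
      moreover have "dist (a * c i) (a * x) = \<bar>a\<bar> * dist (c i) x"
        by (simp add: dist_real_def abs_mult[symmetric] algebra_simps)
      ultimately have "y \<in> ball (a * c i) (\<bar>a\<bar> * r i)" using False by simp
      then show "y \<in> (\<Union>i. ball (a * c i) (\<bar>a\<bar> * r i))" by blast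
    qed
    moreover have "(\<Sum>i. ennreal ((\<bar>a\<bar> * r i) powr t)) < ennreal \<epsilon>"
    proof -
      have "(\<Sum>i. ennreal ((\<bar>a\<bar> * r i) powr t)) = (\<Sum>i. ennreal (\<bar>a\<bar> powr t) * ennreal (r i powr t))"
        using * by (simp add: powr_mult less_imp_le ennreal_mult)
      also have "\<dots> = ennreal (\<bar>a\<bar> powr t) * (\<Sum>i. ennreal (r i powr t))" by (rule ennreal_suminf_cmult)
      also have "\<dots> < ennreal (\<bar>a\<bar> powr t) * ennreal (\<epsilon> / \<bar>a\<bar> powr t)"
        using * at by (intro ennreal_mult_strict_left_mono) auto
      also have "\<dots> = ennreal \<epsilon>" using at e by (simp add: ennreal_mult[symmetric])
      finally show ?thesis .
    qed
    moreover have "\<forall>i. 0 < \<bar>a\<bar> * r i" using * False by simp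
    ultimately show "\<exists>c r. (\<forall>i::nat. 0 < r i) \<and> (\<lambda>x. a * x) ` E \<subseteq> (\<Union>i. ball (c i) (r i)) \<and>
      (\<Sum>i. ennreal (r i powr t)) < ennreal \<epsilon>"
      by (intro exI[of _ "\<lambda>i. a * c i"] exI[of _ "\<lambda>i. \<bar>a\<bar> * r i"] conjI)
  qed
qed

lemma hausdorff_null_compact_cover:
  assumes "hausdorff_null t E" "compact E" "0 < t" "0 < \<epsilon>"
  obtains I :: "nat set" and c r where "finite I" "\<And>i. 0 < r i" "\<And>i. r i < 1"
    "E \<subseteq> (\<Union>i\<in>I. ball (c i) (r i))" "(\<Sum>i\<in>I. r i powr t) < \<epsilon>"
proof -
  obtain c r where *: "\<And>i::nat. 0 < r i" "\<And>i. r i < 1" "E \<subseteq> (\<Union>i. ball (c i) (r i))"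
    "(\<Sum>i. ennreal (r i powr t)) < ennreal \<epsilon>"
    by (rule hausdorff_nullE[OF assms(1,3,4) zero_less_one]) (rule that)
  obtain I where I: "finite I" "E \<subseteq> (\<Union>i\<in>I. ball (c i) (r i))"
    using compactE_image[OF assms(2), of UNIV "\<lambda>i. ball (c i) (r i)"] *(3) by auto
  have "ennreal (\<Sum>i\<in>I. r i powr t) = (\<Sum>i\<in>I. ennreal (r i powr t))"
    by (intro sum_ennreal[symmetric]) auto
  also have "\<dots> \<le> (\<Sum>i. ennreal (r i powr t))" using I by (intro sum_le_suminf) auto
  also note *(4)
  finally have "(\<Sum>i\<in>I. r i powr t) < \<epsilon>" by (metis ennreal_leI not_le)
  then show ?thesis using that I * by blast
qed

text \<open>
  A set \<open>U i\<close> of a cover lies in a ball about any of its points, of radius slightly above the diameter of \<open>U i\<close>. The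
  radius is chosen so that its \<open>t\<close>-th power exceeds that of the diameter by exactly the \<open>i\<close>-th term of a small
  geometric series. The strict inequality \<open>s < t\<close> also covers \<open>s = 0\<close>, where every nonempty set counts \<open>1\<close>.
\<close>

lemma hausdorff_measure_zero_imp_hausdorff_null:
  assumes "0 \<le> s" "s < t" "hausdorff_measure s E = 0"
  shows "hausdorff_null t E"
  unfolding hausdorff_null_def
proof (intro allI impI)
  fix \<epsilon> :: real assume e: "0 < \<epsilon>"
  have t: "0 < t" using assms by simp
  have "hausdorff_premeasure s 1 E \<le> hausdorff_measure s E"
    unfolding hausdorff_measure_def by (intro SUP_upper) auto
  then have "(INF U\<in>delta_covers 1 E. \<Sum>i. diam_power s (U i)) < ennreal (\<epsilon>/2)"
    using assms(3) e by (simp add: hausdorff_premeasure_def)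
  then obtain U where U: "U \<in> delta_covers 1 E" "(\<Sum>i. diam_power s (U i)) < ennreal (\<epsilon>/2)"
    by (auto simp: INF_less_iff)
  have bd: "bounded (U i)" "diameter (U i) \<le> 1" for i using U(1) by (auto simp: delta_covers_def)
  define \<eta> where "\<eta> i = \<epsilon>/2 * (1/2)^Suc i" for i
  have \<eta>: "0 < \<eta> i" for i using e by (simp add: \<eta>_def)
  define D where "D i = (if U i = {} then 0 else diameter (U i) powr t)" for i
  have D: "0 \<le> D i" for i by (simp add: D_def)
  define r where "r i = (D i + \<eta> i) powr (1/t)" for i
  define c where "c i = (SOME x. x \<in> U i)" for i
  have rt: "r i powr t = D i + \<eta> i" for i using D[of i] \<eta>[of i] t by (simp add: r_def powr_powr)
  have rpos: "0 < r i" for i using D[of i] \<eta>[of i] by (simp add: r_def)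
  have sub: "U i \<subseteq> ball (c i) (r i)" for i
  proof
    fix x assume x: "x \<in> U i"
    then have c: "c i \<in> U i" unfolding c_def by (rule someI)
    have "dist (c i) x \<le> diameter (U i)" using diameter_bounded_bound[OF bd(1) c x] .
    also have "\<dots> = (diameter (U i) powr t) powr (1/t)"
      using t diameter_ge_0[OF bd(1)] by (simp add: powr_powr)
    also have "\<dots> < (diameter (U i) powr t + \<eta> i) powr (1/t)"
      using \<eta>[of i] t by (intro powr_less_mono2) auto
    also have "\<dots> = r i" using x by (auto simp: r_def D_def)
    finally show "x \<in> ball (c i) (r i)" by simp
  qed
  have "E \<subseteq> (\<Union>i. ball (c i) (r i))"
    using U(1) sub unfolding delta_covers_def by blast
  moreover have "(\<Sum>i. ennreal (r i powr t)) < ennreal \<epsilon>"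
  proof -
    have "ennreal (D i) \<le> diam_power s (U i)" for i
    proof (cases "U i = {}")
      case False
      have "diameter (U i) powr t \<le> diameter (U i) powr s"
        using bd diameter_ge_0[OF bd(1)] assms by (intro powr_mono') auto
      moreover have "diameter (U i) powr t \<le> 1"
        using bd diameter_ge_0[OF bd(1)] t by (intro powr_le1) auto
      ultimately show ?thesis using False by (auto simp: D_def diam_power_def ennreal_leI)
    qed (simp add: D_def diam_power_def)
    then have "(\<Sum>i. ennreal (r i powr t)) \<le> (\<Sum>i. diam_power s (U i) + ennreal (\<eta> i))"
      unfolding rt using D \<eta> by (intro suminf_le) (auto simp: ennreal_plus less_imp_le intro: add_right_mono)
    also have "\<dots> = (\<Sum>i. diam_power s (U i)) + (\<Sum>i. ennreal (\<eta> i))"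
      by (rule suminf_add[symmetric]) auto
    also have "(\<Sum>i. ennreal (\<eta> i)) = ennreal (\<epsilon>/2)"
      unfolding \<eta>_def using e by (intro suminf_geometric_ennreal) auto
    also have "(\<Sum>i. diam_power s (U i)) + ennreal (\<epsilon>/2) < ennreal (\<epsilon>/2) + ennreal (\<epsilon>/2)"
      using U(2) by (simp add: ennreal_add_left_cancel_less add.commute)
    also have "\<dots> = ennreal \<epsilon>" using e by (simp add: ennreal_plus[symmetric])
    finally show ?thesis .
  qed
  ultimately show "\<exists>c r. (\<forall>i::nat. 0 < r i) \<and> E \<subseteq> (\<Union>i. ball (c i) (r i)) \<and>
     (\<Sum>i. ennreal (r i powr t)) < ennreal \<epsilon>" using rpos by blast
qed

lemma hausdorff_null_imp_hausdorff_measure_zero: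
  assumes t: "0 < t" and "hausdorff_null t E"
  shows "hausdorff_measure t E = 0"
proof -
  have "hausdorff_premeasure t \<delta> E \<le> ennreal \<epsilon>" if d: "0 < \<delta>" and e: "0 < \<epsilon>" for \<delta> \<epsilon>
  proof -
    have e2: "0 < \<epsilon> / 2 powr t" "0 < \<delta>/2" using d e by auto
    obtain c r where cr: "\<And>i::nat. 0 < r i" "\<And>i. r i < \<delta>/2" "E \<subseteq> (\<Union>i. ball (c i) (r i))"
      "(\<Sum>i. ennreal (r i powr t)) < ennreal (\<epsilon> / 2 powr t)"
      by (rule hausdorff_nullE[OF assms(2) t e2]) (rule that)
    have dm: "diameter (ball (c i) (r i)) \<le> 2 * r i" for i
    proof (rule diameter_le)
      fix x y assume "x \<in> ball (c i) (r i)" "y \<in> ball (c i) (r i)"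
      then show "norm (x - y) \<le> 2 * r i" by (auto simp: dist_real_def abs_if split: if_splits)
    qed (use cr(1)[of i] in auto)
    have "diameter (ball (c i) (r i)) \<le> \<delta>" for i using dm[of i] cr(2)[of i] by linarith
    then have "(\<lambda>i. ball (c i) (r i)) \<in> delta_covers \<delta> E"
      using cr(3) by (simp add: delta_covers_def)
    then have "hausdorff_premeasure t \<delta> E \<le> (\<Sum>i. diam_power t (ball (c i) (r i)))"
      unfolding hausdorff_premeasure_def by (rule INF_lower)
    also have "\<dots> \<le> (\<Sum>i. ennreal (2 powr t) * ennreal (r i powr t))"
    proof (intro suminf_le)
      fix i
      have "diameter (ball (c i) (r i)) powr t \<le> (2 * r i) powr t"
        using dm t by (intro powr_mono2 diameter_ge_0) auto
      also have "\<dots> = 2 powr t * r i powr t" using cr(1)[of i] by (simp add: powr_mult)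
      finally show "diam_power t (ball (c i) (r i)) \<le> ennreal (2 powr t) * ennreal (r i powr t)"
        using t by (auto simp: diam_power_def ennreal_mult[symmetric] ennreal_leI)
    qed auto
    also have "\<dots> = ennreal (2 powr t) * (\<Sum>i. ennreal (r i powr t))" by (rule ennreal_suminf_cmult)
    also have "\<dots> \<le> ennreal (2 powr t) * ennreal (\<epsilon> / 2 powr t)"
      using cr(4) by (intro mult_left_mono) auto
    also have "\<dots> = ennreal \<epsilon>" using e by (simp add: ennreal_mult[symmetric])
    finally show ?thesis .
  qed
  note small = this
  have "hausdorff_measure t E \<le> 0"
    unfolding hausdorff_measure_def
  proof (rule SUP_least)
    fix \<delta> :: real assume "\<delta> \<in> {0<..}"
    then show "hausdorff_premeasure t \<delta> E \<le> 0"
      using small[of \<delta>] ennreal_le_epsilon[of 0 "hausdorff_premeasure t \<delta> E"] by simp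
  qed
  then show ?thesis by simp
qed

text \<open>
  The only link to the definition of Hausdorff dimension that the rest uses.
\<close>

lemma hausdorff_dim_le_iff:
  assumes "0 \<le> d"
  shows "hausdorff_dim E \<le> ennreal d \<longleftrightarrow> (\<forall>t>d. hausdorff_null t E)"
proof
  assume le: "hausdorff_dim E \<le> ennreal d"
  show "\<forall>t>d. hausdorff_null t E"
  proof (intro allI impI)
    fix t assume t: "d < t"
    have "hausdorff_dim E < ennreal t" using le t assms by (simp add: ennreal_lessI order_le_less_trans)
    then obtain s where "0 \<le> s" "hausdorff_measure s E = 0" "ennreal s < ennreal t"
      unfolding hausdorff_dim_def by (auto simp: Inf_less_iff)
    then show "hausdorff_null t E" by (intro hausdorff_measure_zero_imp_hausdorff_null[of s]) (auto simp: ennreal_less_iff)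
  qed
next
  assume *: "\<forall>t>d. hausdorff_null t E"
  show "hausdorff_dim E \<le> ennreal d"
  proof (rule ennreal_le_epsilon)
    fix e :: real assume e: "0 < e"
    have "hausdorff_measure (d+e) E = 0" using * e assms by (intro hausdorff_null_imp_hausdorff_measure_zero) auto
    then have "hausdorff_dim E \<le> ennreal (d+e)"
      unfolding hausdorff_dim_def using e assms by (intro Inf_lower) (auto simp del: ennreal_plus)
    then show "hausdorff_dim E \<le> ennreal d + ennreal e" using e assms by (simp add: ennreal_plus)
  qed
qed

lemma hausdorff_dim_mono:
  fixes E F :: "real set"
  assumes "E \<subseteq> F"
  shows "hausdorff_dim E \<le> hausdorff_dim F"
proof (cases "hausdorff_dim F")
  case (real d)
  then have "\<forall>t>d. hausdorff_null t F" using hausdorff_dim_le_iff[of d F] by auto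
  then have "\<forall>t>d. hausdorff_null t E" using hausdorff_null_subset[OF _ assms] by simp
  then show ?thesis using hausdorff_dim_le_iff[of d E] real by auto
qed simp

section \<open>Sigma-compact rational spans\<close>

lemma fsigma_UN_compact:
  fixes F :: "'i::countable \<Rightarrow> real set"
  assumes "\<And>i. compact (F i)"
  shows "fsigma (\<Union>i. F i)"
proof -
  have "(\<Union>i. F i) = (\<Union>n. F (from_nat n))" by auto (metis from_nat_to_nat)
  then show ?thesis using assms unfolding fsigma_Union_compact
    by (intro exI[of _ "\<lambda>n. F (from_nat n)"]) auto
qed

lemma fsigma_UN:
  fixes S :: "'i::countable \<Rightarrow> real set"
  assumes "\<And>i. fsigma (S i)"
  shows "fsigma (\<Union>i. S i)"
proof -
  have "\<forall>i. \<exists>F::nat \<Rightarrow> real set. (\<forall>n. compact (F n)) \<and> S i = (\<Union>n. F n)"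
    using assms unfolding fsigma_Union_compact by (metis image_subset_iff mem_Collect_eq UNIV_I)
  then obtain F :: "'i \<Rightarrow> nat \<Rightarrow> real set" where F: "\<And>i n. compact (F i n)" "\<And>i. S i = (\<Union>n. F i n)"
    by metis
  have "(\<Union>i. S i) = (\<Union>(i, n). F i n)" using F(2) by auto
  then show ?thesis using F(1) by (simp add: fsigma_UN_compact split_def)
qed

lemma fsigma_Un:
  fixes S T :: "real set"
  assumes "fsigma S" "fsigma T"
  shows "fsigma (S \<union> T)"
proof -
  have "S \<union> T = (\<Union>b. if b then S else T)" by (auto split: if_splits)
  moreover have "fsigma (\<Union>b. if b then S else T)" using assms by (intro fsigma_UN) simp
  ultimately show ?thesis by simp
qed

lemma fsigma_compact_exhaustion:
  fixes S :: "real set"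
  assumes "fsigma S"
  obtains C :: "nat \<Rightarrow> real set" where "\<And>n. compact (C n)" "\<And>m n. m \<le> n \<Longrightarrow> C m \<subseteq> C n" "S = (\<Union>n. C n)"
proof -
  obtain F :: "nat \<Rightarrow> real set" where F: "\<And>n. compact (F n)" "S = (\<Union>n. F n)"
    using assms unfolding fsigma_Union_compact by (metis image_subset_iff mem_Collect_eq UNIV_I)
  show ?thesis
  proof
    show "compact (\<Union>i\<le>n. F i)" for n using F(1) by (intro compact_UN) auto
    show "(\<Union>i\<le>m. F i) \<subseteq> (\<Union>i\<le>n. F i)" if "m \<le> n" for m n using that by (intro UN_mono) auto
    show "S = (\<Union>n. \<Union>i\<le>n. F i)" using F(2) by auto
  qed
qed

text \<open>
  Recursion on the list of coefficients presents the span as a countable union over lists, each member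
  being an iterated sum of scaled compact sets.
\<close>

fun combinations :: "(nat \<Rightarrow> real set) \<Rightarrow> (rat \<times> nat) list \<Rightarrow> real set" where
  "combinations F [] = {0}"
| "combinations F ((q, n) # l) = {of_rat q * x + y | x y. x \<in> F n \<and> y \<in> combinations F l}"

lemma compact_combinations:
  assumes "\<And>n. compact (F n)"
  shows "compact (combinations F l)"
proof (induction l)
  case (Cons p l)
  obtain q n where p: "p = (q, n)" by fastforce
  have "{of_rat q * x + y | x y. x \<in> F n \<and> y \<in> combinations F l} =
     {x + y | x y. x \<in> (\<lambda>x. of_rat q *\<^sub>R x) ` F n \<and> y \<in> combinations F l}" by auto
  moreover have "compact {x + y | x y. x \<in> (\<lambda>x. of_rat q *\<^sub>R x) ` F n \<and> y \<in> combinations F l}"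
    by (intro compact_sums compact_scaling assms Cons)
  ultimately show ?case by (simp add: p)
qed auto

lemma fsigma_rat_span:
  assumes "fsigma S"
  shows "fsigma (rat_real.span S)"
proof -
  obtain F :: "nat \<Rightarrow> real set" where F: "\<And>n. compact (F n)" "S = (\<Union>n. F n)"
    using assms unfolding fsigma_Union_compact by (metis image_subset_iff mem_Collect_eq UNIV_I)
  have "combinations F l \<subseteq> rat_real.span S" for l
  proof (induction l)
    case (Cons p l)
    obtain q n where p: "p = (q, n)" by fastforce
    have "of_rat q * x + y \<in> rat_real.span S" if "x \<in> F n" "y \<in> combinations F l" for x y
    proof (rule rat_real.span_add)
      show "of_rat q * x \<in> rat_real.span S"
        using that F(2) by (intro rat_real.span_scale rat_real.span_base) auto
      show "y \<in> rat_real.span S" using that Cons by blast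
    qed
    then show ?case by (auto simp: p)
  qed (simp add: rat_real.span_zero)
  moreover have "x \<in> (\<Union>l. combinations F l)" if "x \<in> rat_real.span S" for x
    using that
  proof (induction rule: rat_real.span_induct_alt)
    case base
    show ?case by (auto intro!: exI[of _ "[]"])
  next
    case (step q x y)
    then obtain n l where "x \<in> F n" "y \<in> combinations F l" using F(2) by auto
    then have "of_rat q * x + y \<in> combinations F ((q, n) # l)" by auto
    then show ?case by blast
  qed
  ultimately have "rat_real.span S = (\<Union>l. combinations F l)" by blast
  then show ?thesis using F(1) by (simp add: fsigma_UN_compact compact_combinations)
qed

lemma add_subgroup_of_nat_mult:
  assumes "add_subgroup (B::real set)" "x \<in> B"
  shows "of_nat n * x \<in> B"
  using assms by (induction n) (auto simp: add_subgroup_def algebra_simps)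

lemma add_subgroup_of_int_mult:
  assumes "add_subgroup (B::real set)" "x \<in> B"
  shows "of_int n * x \<in> B"
  using add_subgroup_of_nat_mult[OF assms, of "nat n"] add_subgroup_of_nat_mult[OF assms, of "nat (- n)"]
    assms(1) by (cases "0 \<le> n") (auto simp: add_subgroup_def)

text \<open>
  Clearing denominators: a subgroup already contains the integer combinations of its elements. Hence the
  rational span of a subgroup is a countable union of scaled copies, and passing to it is harmless for null sets.
\<close>

lemma rat_span_subgroup:
  assumes B: "add_subgroup B" and "x \<in> rat_real.span B"
  obtains N :: nat where "0 < N" "real N * x \<in> B"
proof -
  have "\<exists>N::nat. 0 < N \<and> real N * x \<in> B"
    using assms(2)
  proof (induction rule: rat_real.span_induct_alt)
    case base
    then show ?case using B by (intro exI[of _ 1]) (auto simp: add_subgroup_def)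
  next
    case (step q x y)
    then obtain N where N: "0 < N" "real N * y \<in> B" by auto
    obtain a b where ab: "quotient_of q = (a, b)" by fastforce
    have b: "0 < b" using quotient_of_denom_pos[OF ab] .
    have q: "(of_rat q :: real) = of_int a / of_int b"
      using quotient_of_div[OF ab] by (simp add: of_rat_divide)
    have "real_of_int (int N * a) * x + real_of_int b * (real N * y) \<in> B"
      using B step N add_subgroup_of_int_mult[OF B] unfolding add_subgroup_def by blast
    moreover have "real (N * nat b) * (of_rat q * x + y) = real_of_int (int N * a) * x + real_of_int b * (real N * y)"
      using b by (simp add: q field_simps)
    ultimately show ?case using N b by (intro exI[of _ "N * nat b"]) auto
  qed
  then show ?thesis using that by blast
qed

lemma hausdorff_null_rat_span:
  assumes "add_subgroup B" "hausdorff_null t B"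
  shows "hausdorff_null t (rat_real.span B)"
proof (rule hausdorff_null_subset)
  show "hausdorff_null t (\<Union>N::nat. (\<lambda>x. 1 / real N * x) ` B)"
    by (intro hausdorff_null_UN hausdorff_null_scale assms)
  show "rat_real.span B \<subseteq> (\<Union>N::nat. (\<lambda>x. 1 / real N * x) ` B)"
  proof
    fix x assume "x \<in> rat_real.span B"
    then obtain N where "0 < N" "real N * x \<in> B" using rat_span_subgroup assms(1) by blast
    then show "x \<in> (\<Union>N::nat. (\<lambda>x. 1 / real N * x) ` B)"
      by (intro UN_I[of N] image_eqI[of _ _ "real N * x"]) auto
  qed
qed

section \<open>Mixed radix digits\<close>

definition digit_seqs :: "(nat \<Rightarrow> nat) \<Rightarrow> (nat \<Rightarrow> nat) set" where
  "digit_seqs M = {u. \<forall>i. u i < M i}"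

definition radix :: "(nat \<Rightarrow> nat) \<Rightarrow> nat \<Rightarrow> nat" where
  "radix M k = (\<Prod>i<k. M i)"

lemma radix_0 [simp]: "radix M 0 = 1" by (simp add: radix_def)

lemma radix_Suc: "radix M (Suc k) = radix M k * M k" by (simp add: radix_def)

lemma digit_seqs_less: "u \<in> digit_seqs M \<Longrightarrow> u i < M i" by (simp add: digit_seqs_def)

lemma compact_digit_seqs: "compact (digit_seqs M)"
proof -
  have eq: "digit_seqs M = PiE UNIV (\<lambda>i. {..<M i})"
    by (auto simp: digit_seqs_def PiE_def Pi_def)
  have "compactin (product_topology (\<lambda>_. euclidean) UNIV) (PiE UNIV (\<lambda>i. {..<M i}))"
    by (simp add: compactin_PiE finite_imp_compact)
  then show ?thesis by (simp add: eq euclidean_product_topology)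
qed

text \<open>
  Digit sequences agreeing with \<open>u\<close> in finitely many places form a neighbourhood of \<open>u\<close> in the product topology, so
  such functions are locally constant.
\<close>

lemma continuous_on_finite_dependence:
  fixes f :: "(nat \<Rightarrow> nat) \<Rightarrow> 'b::topological_space"
  assumes "\<And>u v. u \<in> X \<Longrightarrow> v \<in> X \<Longrightarrow> (\<And>i. i < n \<Longrightarrow> u i = v i) \<Longrightarrow> f u = f v"
  shows "continuous_on X f"
  unfolding continuous_on_def
proof
  fix u assume u: "u \<in> X"
  have "eventually (\<lambda>v. v i = u i) (at u within X)" for i
  proof -
    have "continuous_on X (\<lambda>v. v i)"
      by (rule continuous_on_subset[OF continuous_on_product_coordinates subset_UNIV])
    then have "((\<lambda>v. v i) \<longlongrightarrow> u i) (at u within X)"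
      using u by (simp add: continuous_on_def)
    then show ?thesis by (simp add: tendsto_discrete)
  qed
  then have "eventually (\<lambda>v. \<forall>i\<in>{..<n}. v i = u i) (at u within X)"
    by (intro eventually_ball_finite) auto
  moreover have "eventually (\<lambda>v. v \<in> X) (at u within X)"
    by (simp add: eventually_at_filter)
  ultimately have "eventually (\<lambda>v. f v = f u) (at u within X)"
  proof eventually_elim
    case (elim v)
    then show ?case using assms[of v u] u by simp
  qed
  then show "(f \<longlongrightarrow> f u) (at u within X)" by (rule tendsto_eventually)
qed

lemma continuous_on_suminf:
  fixes f :: "nat \<Rightarrow> 'a::topological_space \<Rightarrow> real"
  assumes "\<And>k. continuous_on X (f k)" "\<And>k u. u \<in> X \<Longrightarrow> \<bar>f k u\<bar> \<le> e k" "summable e"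
  shows "continuous_on X (\<lambda>u. \<Sum>k. f k u)"
proof (rule uniform_limit_theorem)
  show "uniform_limit X (\<lambda>n u. \<Sum>k<n. f k u) (\<lambda>u. \<Sum>k. f k u) sequentially"
    using assms by (intro Weierstrass_m_test) auto
  show "\<forall>\<^sub>F n in sequentially. continuous_on X (\<lambda>u. \<Sum>k<n. f k u)"
    using assms by (intro always_eventually allI continuous_intros) auto
qed simp

lemma radix_ge_power2: "(\<And>i. 2 \<le> M i) \<Longrightarrow> 2 ^ k \<le> radix M k"
proof (induction k)
  case (Suc k)
  have "2 ^ k * 2 \<le> radix M k * M k" using Suc by (intro mult_le_mono) auto
  then show ?case by (simp add: radix_Suc mult.commute)
qed simp

lemma radix_pos: "(\<And>i. 2 \<le> M i) \<Longrightarrow> 0 < radix M k"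
  by (rule order_less_le_trans[OF _ radix_ge_power2]) simp_all

text \<open>
  The digits are the jumps of the integer parts of \<open>t * radix M k\<close>; the partial sums are these integer parts
  divided by \<open>radix M k\<close>.
\<close>

lemma mixed_radix_expansion:
  assumes M: "\<And>i. 2 \<le> M i" and t: "0 \<le> t" "t < (1::real)"
  obtains u where "u \<in> digit_seqs M" "(\<lambda>i. real (u i) / real (radix M (Suc i))) sums t"
proof -
  define F where "F k = \<lfloor>t * real (radix M k)\<rfloor>" for k
  define u where "u k = nat (F (Suc k) - int (M k) * F k)" for k
  have step: "int (M k) * F k \<le> F (Suc k)" "F (Suc k) < int (M k) * F k + int (M k)" for k
  proof -
    have Mp: "0 < real (M k)" using M[of k] by auto
    have eq: "t * real (radix M (Suc k)) = real (M k) * (t * real (radix M k))" by (simp add: radix_Suc)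
    have "real_of_int (F k) \<le> t * real (radix M k)" "t * real (radix M k) < real_of_int (F k) + 1"
      unfolding F_def by linarith+
    then have "real (M k) * real_of_int (F k) \<le> t * real (radix M (Suc k))"
       "t * real (radix M (Suc k)) < real (M k) * (real_of_int (F k) + 1)"
      unfolding eq using Mp by (auto intro: mult_left_mono)
    then have "real_of_int (int (M k) * F k) \<le> t * real (radix M (Suc k))"
       "t * real (radix M (Suc k)) < real_of_int (int (M k) * F k + int (M k))"
      by (simp_all add: algebra_simps)
    then show "int (M k) * F k \<le> F (Suc k)" "F (Suc k) < int (M k) * F k + int (M k)"
      unfolding F_def[of "Suc k"] by linarith+
  qed
  have uF: "real (u k) = real_of_int (F (Suc k)) - real (M k) * real_of_int (F k)" for k
    using step(1)[of k] by (simp add: u_def)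
  have "u i < M i" for i using step(1,2)[of i] by (simp add: u_def nat_less_iff)
  then have "u \<in> digit_seqs M" by (simp add: digit_seqs_def)
  moreover have part: "(\<Sum>i<k. real (u i) / real (radix M (Suc i))) = real_of_int (F k) / real (radix M k)" for k
  proof (induction k)
    case 0
    have "F 0 = 0" using t by (simp add: F_def floor_eq_iff)
    then show ?case by simp
  next
    case (Suc k)
    have "0 < M k" using M[of k] by linarith
    moreover have "0 < radix M k" using radix_pos[of M k] M by simp
    ultimately show ?case using Suc by (simp add: uF radix_Suc field_simps)
  qed
  have "(\<lambda>k. real_of_int (F k) / real (radix M k)) \<longlonglongrightarrow> t"
  proof (rule LIM_zero_cancel)
    show "(\<lambda>k. real_of_int (F k) / real (radix M k) - t) \<longlonglongrightarrow> 0"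
    proof (rule Lim_null_comparison)
      show "\<forall>\<^sub>F k in sequentially. norm (real_of_int (F k) / real (radix M k) - t) \<le> (1/2)^k"
      proof (intro always_eventually allI)
        fix k
        have p: "0 < real (radix M k)" using radix_pos[of M k] M by simp
        have "real_of_int (F k) \<le> t * real (radix M k)" "t * real (radix M k) < real_of_int (F k) + 1"
          unfolding F_def by linarith+
        then have "\<bar>real_of_int (F k) - t * real (radix M k)\<bar> \<le> 1" by linarith
        then have "\<bar>real_of_int (F k) - t * real (radix M k)\<bar> / real (radix M k) \<le> 1 / real (radix M k)"
          using p by (intro divide_right_mono) auto
        moreover have "real_of_int (F k) / real (radix M k) - t = (real_of_int (F k) - t * real (radix M k)) / real (radix M k)"
          using p by (simp add: diff_divide_distrib)
        ultimately have "norm (real_of_int (F k) / real (radix M k) - t) \<le> 1 / real (radix M k)"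
          using p by (simp add: abs_divide)
        also have "\<dots> \<le> 1 / 2 ^ k"
        proof -
          have "real (2 ^ k) \<le> real (radix M k)" using radix_ge_power2[OF M] by (simp only: of_nat_le_iff)
          then show ?thesis by (simp add: frac_le)
        qed
        finally show "norm (real_of_int (F k) / real (radix M k) - t) \<le> (1/2)^k" by (simp add: power_divide)
      qed
      show "(\<lambda>k. (1/2::real)^k) \<longlonglongrightarrow> 0" by (rule LIMSEQ_power_zero) simp
    qed
  qed
  then have "(\<lambda>i. real (u i) / real (radix M (Suc i))) sums t" by (simp add: sums_def part)
  ultimately show ?thesis using that by blast
qed

text \<open>
  The counting principle behind all covers: before stage \<open>k\<close> there are only \<open>radix M k\<close> different prefixes.
\<close>

lemma finite_prefix_values:
  assumes X: "X \<subseteq> digit_seqs M" and f: "\<And>u v. (\<And>i. i < k \<Longrightarrow> u i = v i) \<Longrightarrow> f u = f v"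
  shows "finite (f ` X)" "card (f ` X) \<le> radix M k"
proof -
  define F where "F = (PiE {..<k} (\<lambda>i. {..<M i}) :: (nat \<Rightarrow> nat) set)"
  have fin: "finite F" unfolding F_def by (intro finite_PiE) auto
  have sub: "f ` X \<subseteq> f ` F"
  proof
    fix y assume "y \<in> f ` X"
    then obtain u where u: "u \<in> X" "y = f u" by blast
    then have "restrict u {..<k} \<in> F" using X by (auto simp: F_def digit_seqs_def)
    moreover have "f u = f (restrict u {..<k})" by (rule f) simp
    ultimately show "y \<in> f ` F" using u(2) by blast
  qed
  then show "finite (f ` X)" using fin by (meson finite_imageI finite_subset)
  have "card (f ` X) \<le> card (f ` F)" using sub fin by (intro card_mono) auto
  also have "\<dots> \<le> card F" by (rule card_image_le[OF fin])
  also have "\<dots> = radix M k" by (simp add: F_def card_PiE radix_def)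
  finally show "card (f ` X) \<le> radix M k" .
qed

section \<open>Directions prescribed by recurring patterns\<close>

text \<open>
  An entry \<open>((j, \<sigma>), (n, m))\<close> of a table stands for the term \<open>n * a + m * b\<close>, where \<open>a\<close> and \<open>b\<close> belong to \<open>\<xi> j\<close> and to a digit
  sequence with prefix \<open>\<sigma>\<close>. Rational coefficients and finite prefixes make the tables a countable type.
\<close>

type_synonym entry = "(nat \<times> nat list) \<times> (rat \<times> rat)"

text \<open>
  The point on the line \<open>c + x * e = 1\<close> that is orthogonal to the rational vector \<open>p\<close>. It exists for \<open>p\<close> other than the zero
  vector when \<open>x\<close> is irrational; the zero vector is orthogonal to everything, so any point of the line does.
\<close>

definition annihilator :: "real \<Rightarrow> rat \<times> rat \<Rightarrow> real \<times> real" where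
  "annihilator x = (\<lambda>(n, m). if n = 0 \<and> m = 0 then (1, 0)
     else (of_rat m / (of_rat m - x * of_rat n), - of_rat n / (of_rat m - x * of_rat n)))"

lemma annihilator_orthogonal:
  "of_rat n * fst (annihilator x (n, m)) + of_rat m * snd (annihilator x (n, m)) = 0"
  by (simp add: annihilator_def)

lemma annihilator_normalised:
  assumes "x \<notin> \<rat>"
  shows "fst (annihilator x p) + x * snd (annihilator x p) = 1"
proof -
  obtain n m where p: "p = (n, m)" by fastforce
  have "of_rat m - x * of_rat n \<noteq> 0" if "\<not> (n = 0 \<and> m = 0)"
  proof
    assume eq: "of_rat m - x * of_rat n = 0"
    have "n \<noteq> 0" using eq that by auto
    then have "x = of_rat (m / n)" using eq by (simp add: of_rat_divide field_simps)
    then show False using assms by simp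
  qed
  then show ?thesis by (auto simp: p annihilator_def diff_divide_distrib[symmetric])
qed

text \<open>
  Decoding a pair and dropping its second component makes every table, together with the length of its
  prefixes, recur infinitely often.
\<close>

definition pattern :: "nat \<Rightarrow> nat \<times> entry list" where
  "pattern k = from_nat (fst (prod_decode k))"

lemma pattern_recurs: obtains k where "k \<ge> N" "pattern k = p"
proof
  show "prod_encode (to_nat p, N) \<ge> N" by (rule le_prod_encode_2)
  show "pattern (prod_encode (to_nat p, N)) = p" by (simp add: pattern_def)
qed

text \<open>
  The proportions in which the \<open>k\<close>-th digit is split between \<open>a\<close> and \<open>b\<close>. The condition \<open>L \<le> k\<close> makes them depend
  only on the digits before \<open>k\<close>, which is what the counting of prefixes needs. A sequence that does not
  occur in the current table gives its digit entirely to \<open>a\<close>.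
\<close>

definition direction :: "(nat \<Rightarrow> real) \<Rightarrow> nat \<Rightarrow> nat \<Rightarrow> (nat \<Rightarrow> nat) \<Rightarrow> real \<times> real" where
  "direction \<xi> k j u = (case pattern k of (L, w) \<Rightarrow>
     if L \<le> k then
       (case map_of w (j, map u [0..<L]) of None \<Rightarrow> (1, 0) | Some p \<Rightarrow> annihilator (\<xi> j) p)
     else (1, 0))"

lemma direction_normalised:
  assumes "\<xi> j \<notin> \<rat>"
  shows "fst (direction \<xi> k j u) + \<xi> j * snd (direction \<xi> k j u) = 1"
  by (simp add: direction_def annihilator_normalised[OF assms] split: prod.split option.split)

lemma direction_cong:
  assumes "\<And>i. i < k \<Longrightarrow> u i = v i"
  shows "direction \<xi> k j u = direction \<xi> k j v"
proof -
  obtain L w where p: "pattern k = (L, w)" by fastforce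
  show ?thesis
  proof (cases "L \<le> k")
    case True
    then have "map u [0..<L] = map v [0..<L]" using assms by simp
    then show ?thesis by (simp add: direction_def p del: map_eq_conv)
  qed (simp add: direction_def p)
qed

text \<open>
  A table contains finitely many entries, so only finitely many directions occur at a given stage, over
  all \<open>j\<close> and all digit sequences. The bound is independent of the radices, which are chosen later.
\<close>

lemma direction_bounded:
  "\<exists>V. \<forall>j u. \<bar>fst (direction \<xi> k j u)\<bar> \<le> V \<and> \<bar>snd (direction \<xi> k j u)\<bar> \<le> V"
proof -
  obtain L w where p: "pattern k = (L, w)" by fastforce
  define D where "D = insert (1, 0) ((\<lambda>e. annihilator (\<xi> (fst (fst e))) (snd e)) ` set w)"
  have "finite D" by (simp add: D_def)
  have D: "direction \<xi> k j u \<in> D" for j u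
    by (force simp: direction_def p D_def dest!: map_of_SomeD split: option.split)
  define V where "V = Max ((\<lambda>z. max \<bar>fst z\<bar> \<bar>snd z\<bar>) ` D)"
  have "max \<bar>fst z\<bar> \<bar>snd z\<bar> \<le> V" if "z \<in> D" for z
    unfolding V_def using \<open>finite D\<close> that by (intro Max_ge) auto
  from this[OF D] show ?thesis by (intro exI[of _ V]) simp
qed

lemma direction_annihilates:
  assumes "pattern k = (L, w)" "L \<le> k" "map_of w (j, map u [0..<L]) = Some (n, m)"
  shows "of_rat n * fst (direction \<xi> k j u) + of_rat m * snd (direction \<xi> k j u) = 0"
  using assms by (simp add: direction_def annihilator_orthogonal)

text \<open>
  Covering numbers at scale \<open>\<rho>\<close>, with a bound instead of a minimum so that they multiply under sums of sets.
\<close>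

definition covered_by :: "real set \<Rightarrow> nat \<Rightarrow> real \<Rightarrow> bool" where
  "covered_by X N \<rho> \<longleftrightarrow> (\<exists>H. finite H \<and> card H \<le> N \<and> (\<forall>x\<in>X. \<exists>h\<in>H. \<bar>x - h\<bar> \<le> \<rho>))"

lemma covered_by_sumset:
  assumes "covered_by X N \<rho>" "covered_by Y N' \<rho>'"
  shows "covered_by {x + y | x y. x \<in> X \<and> y \<in> Y} (N * N') (\<rho> + \<rho>')"
proof -
  obtain H where H: "finite H" "card H \<le> N" "\<And>x. x \<in> X \<Longrightarrow> \<exists>h\<in>H. \<bar>x - h\<bar> \<le> \<rho>"
    using assms(1) unfolding covered_by_def by blast
  obtain H' where H': "finite H'" "card H' \<le> N'" "\<And>x. x \<in> Y \<Longrightarrow> \<exists>h\<in>H'. \<bar>x - h\<bar> \<le> \<rho>'"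
    using assms(2) unfolding covered_by_def by blast
  define K where "K = (\<lambda>(h, h'). h + h') ` (H \<times> H')"
  have "card K \<le> card (H \<times> H')" unfolding K_def using H H' by (intro card_image_le) auto
  also have "\<dots> \<le> N * N'" using H(2) H'(2) by (simp add: card_cartesian_product mult_le_mono)
  finally have "card K \<le> N * N'" .
  moreover have "finite K" using H H' by (simp add: K_def)
  moreover have "\<exists>k\<in>K. \<bar>z - k\<bar> \<le> \<rho> + \<rho>'" if z: "z \<in> {x + y | x y. x \<in> X \<and> y \<in> Y}" for z
  proof -
    obtain x y where xy: "z = x + y" "x \<in> X" "y \<in> Y" using z by blast
    obtain h where h: "h \<in> H" "\<bar>x - h\<bar> \<le> \<rho>" using H(3) xy by blast
    obtain h' where h': "h' \<in> H'" "\<bar>y - h'\<bar> \<le> \<rho>'" using H'(3) xy by blast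
    have "h + h' \<in> K" using h h' by (force simp: K_def)
    moreover have "\<bar>z - (h + h')\<bar> \<le> \<rho> + \<rho>'" using h h' xy by linarith
    ultimately show ?thesis by blast
  qed
  ultimately show ?thesis unfolding covered_by_def by blast
qed

text \<open>
  The conditions on \<open>\<tau>\<close> say that the digits after stage \<open>k\<close> contribute at most \<open>\<tau> k\<close> in total to \<open>a\<close> and to \<open>b\<close>: stage \<open>k + 1\<close> contributes at
  most \<open>\<tau> k / 2\<close>, and the sequence \<open>\<tau>\<close> at least halves at each stage.
\<close>

locale steered_digits =
  fixes \<xi> :: "nat \<Rightarrow> real" and M :: "nat \<Rightarrow> nat" and V \<tau> :: "nat \<Rightarrow> real"
  assumes irrational: "\<xi> j \<notin> \<rat>"
    and M_ge2: "2 \<le> M i"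
    and direction_le: "\<bar>fst (direction \<xi> k j u)\<bar> \<le> V k" "\<bar>snd (direction \<xi> k j u)\<bar> \<le> V k"
    and \<tau>_pos: "0 < \<tau> k"
    and V_radix: "V (Suc k) / real (radix M (Suc k)) \<le> \<tau> k / 2"
    and \<tau>_halves: "\<tau> (Suc k) \<le> \<tau> k / 2"
begin

abbreviation \<Omega> :: "(nat \<Rightarrow> nat) set" where "\<Omega> \<equiv> digit_seqs M"

definition weighted :: "real \<Rightarrow> real \<Rightarrow> nat \<Rightarrow> (nat \<Rightarrow> nat) \<Rightarrow> nat \<Rightarrow> real" where
  "weighted n m j u k =
     (n * fst (direction \<xi> k j u) + m * snd (direction \<xi> k j u)) * (real (u k) / real (radix M (Suc k)))"

definition a_val :: "nat \<Rightarrow> (nat \<Rightarrow> nat) \<Rightarrow> real" where "a_val j u = (\<Sum>k. weighted 1 0 j u k)"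
definition b_val :: "nat \<Rightarrow> (nat \<Rightarrow> nat) \<Rightarrow> real" where "b_val j u = (\<Sum>k. weighted 0 1 j u k)"

definition tail_bound :: "nat \<Rightarrow> real" where "tail_bound k = V k / real (radix M k)"

lemma V_nonneg: "0 \<le> V k" using direction_le(1)[of k 0 "\<lambda>_. 0"] by linarith

lemma radix_M_pos: "0 < real (radix M k)"
  using radix_pos[of M k] M_ge2 by simp

lemma weighted_le:
  assumes "u \<in> \<Omega>"
  shows "\<bar>weighted n m j u k\<bar> \<le> (\<bar>n\<bar> + \<bar>m\<bar>) * tail_bound k"
proof -
  have "\<bar>n * fst (direction \<xi> k j u) + m * snd (direction \<xi> k j u)\<bar>
      \<le> \<bar>n\<bar> * \<bar>fst (direction \<xi> k j u)\<bar> + \<bar>m\<bar> * \<bar>snd (direction \<xi> k j u)\<bar>"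
    by (metis abs_triangle_ineq abs_mult)
  also have "\<dots> \<le> \<bar>n\<bar> * V k + \<bar>m\<bar> * V k"
    by (intro add_mono mult_left_mono direction_le) auto
  finally have 1: "\<bar>n * fst (direction \<xi> k j u) + m * snd (direction \<xi> k j u)\<bar> \<le> (\<bar>n\<bar> + \<bar>m\<bar>) * V k"
    by (simp add: algebra_simps)
  have Mp: "0 < M k" using M_ge2[of k] by linarith
  have "real (u k) / real (radix M (Suc k)) \<le> real (M k) / real (radix M (Suc k))"
    using digit_seqs_less[OF assms, of k] by (intro divide_right_mono) auto
  also have "\<dots> = 1 / real (radix M k)" using Mp by (simp add: radix_Suc)
  finally have 2: "real (u k) / real (radix M (Suc k)) \<le> 1 / real (radix M k)" .
  have "\<bar>weighted n m j u k\<bar> = \<bar>n * fst (direction \<xi> k j u) + m * snd (direction \<xi> k j u)\<bar>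
      * (real (u k) / real (radix M (Suc k)))"
    by (simp add: weighted_def abs_mult)
  also have "\<dots> \<le> ((\<bar>n\<bar> + \<bar>m\<bar>) * V k) * (1 / real (radix M k))"
    using 1 2 V_nonneg by (intro mult_mono) auto
  finally show ?thesis by (simp add: tail_bound_def)
qed

lemma \<tau>_geometric: "\<tau> (i + k) \<le> \<tau> k * (1/2)^i"
proof (induction i)
  case (Suc i)
  then show ?case using \<tau>_halves[of "i + k"] by simp
qed simp

lemma tail_bound_geometric: "tail_bound (i + Suc k) \<le> \<tau> k * (1/2)^Suc i"
  using V_radix[of "i + k"] \<tau>_geometric[of i k] by (simp add: tail_bound_def)

lemma tail_bound_nonneg: "0 \<le> tail_bound k"
  using V_nonneg by (simp add: tail_bound_def)

lemma summable_tail_bound: "summable tail_bound"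
proof -
  have "summable (\<lambda>i. tail_bound (i + Suc 0))"
  proof (rule summable_comparison_test')
    show "summable (\<lambda>i. \<tau> 0 * (1/2)^Suc i)"
      using sums_mult[OF power_half_series, of "\<tau> 0"] by (simp add: sums_iff)
    show "norm (tail_bound (i + Suc 0)) \<le> \<tau> 0 * (1/2)^Suc i" for i
      using tail_bound_geometric[of i 0] tail_bound_nonneg[of "i + Suc 0"] by simp
  qed
  then show ?thesis by (simp only: summable_iff_shift)
qed

lemma tail_sum_le: "(\<Sum>i. tail_bound (i + Suc k)) \<le> \<tau> k"
proof -
  have s: "(\<lambda>i. \<tau> k * (1/2)^Suc i) sums \<tau> k"
    using sums_mult[OF power_half_series, of "\<tau> k"] by simp
  have "(\<Sum>i. tail_bound (i + Suc k)) \<le> (\<Sum>i. \<tau> k * (1/2)^Suc i)"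
    using tail_bound_geometric summable_tail_bound s
    by (intro suminf_le) (auto simp: sums_iff summable_iff_shift simp del: power_Suc add_Suc_right)
  then show ?thesis using s by (simp add: sums_iff)
qed

lemma summable_weighted:
  assumes "u \<in> \<Omega>"
  shows "summable (weighted n m j u)"
proof (rule summable_comparison_test')
  show "summable (\<lambda>k. (\<bar>n\<bar> + \<bar>m\<bar>) * tail_bound k)" by (intro summable_mult summable_tail_bound)
  show "norm (weighted n m j u k) \<le> (\<bar>n\<bar> + \<bar>m\<bar>) * tail_bound k" for k
    using weighted_le[OF assms] by simp
qed

lemma combination_sums:
  assumes "u \<in> \<Omega>"
  shows "weighted n m j u sums (n * a_val j u + m * b_val j u)"
proof -
  have "(\<lambda>k. n * weighted 1 0 j u k + m * weighted 0 1 j u k) sums (n * a_val j u + m * b_val j u)"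
    unfolding a_val_def b_val_def using assms
    by (intro sums_add sums_mult summable_sums summable_weighted)
  moreover have "(\<lambda>k. n * weighted 1 0 j u k + m * weighted 0 1 j u k) = weighted n m j u"
    by (simp add: weighted_def fun_eq_iff algebra_simps)
  ultimately show ?thesis by simp
qed

text \<open>
  If the direction at stage \<open>k\<close> annihilates \<open>(n, m)\<close>, then stage \<open>k\<close> contributes nothing and the error jumps directly to the
  tail after \<open>k\<close>, of size \<open>\<tau> k\<close>, although the digits before \<open>k\<close> only resolve the scale \<open>1 / radix M k\<close>.
\<close>

lemma combination_near_head:
  assumes u: "u \<in> \<Omega>"
    and kill: "n * fst (direction \<xi> k j u) + m * snd (direction \<xi> k j u) = 0"
  shows "\<bar>(n * a_val j u + m * b_val j u) - (\<Sum>l<k. weighted n m j u l)\<bar> \<le> (\<bar>n\<bar> + \<bar>m\<bar>) * \<tau> k"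
proof -
  have sm: "summable (weighted n m j u)" by (rule summable_weighted[OF u])
  have "n * a_val j u + m * b_val j u = (\<Sum>l. weighted n m j u l)"
    using combination_sums[OF u] by (simp add: sums_iff)
  also have "\<dots> = (\<Sum>l. weighted n m j u (l + Suc k)) + (\<Sum>l<Suc k. weighted n m j u l)"
    by (rule suminf_split_initial_segment[OF sm])
  also have "(\<Sum>l<Suc k. weighted n m j u l) = (\<Sum>l<k. weighted n m j u l)"
    using kill by (simp add: weighted_def)
  finally have eq: "(n * a_val j u + m * b_val j u) - (\<Sum>l<k. weighted n m j u l)
      = (\<Sum>l. weighted n m j u (l + Suc k))" by simp
  have smb: "summable (\<lambda>l. (\<bar>n\<bar> + \<bar>m\<bar>) * tail_bound (l + Suc k))"
    using summable_tail_bound by (intro summable_mult) (simp only: summable_iff_shift)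
  have "norm (\<Sum>l. weighted n m j u (l + Suc k)) \<le> (\<Sum>l. (\<bar>n\<bar> + \<bar>m\<bar>) * tail_bound (l + Suc k))"
    by (rule norm_suminf_le[OF _ smb]) (simp add: weighted_le[OF u] del: add_Suc_right)
  also have "\<dots> = (\<bar>n\<bar> + \<bar>m\<bar>) * (\<Sum>l. tail_bound (l + Suc k))"
    using summable_tail_bound by (intro suminf_mult) (simp only: summable_iff_shift)
  also have "\<dots> \<le> (\<bar>n\<bar> + \<bar>m\<bar>) * \<tau> k" by (intro mult_left_mono tail_sum_le) auto
  finally show ?thesis by (simp add: eq)
qed

lemma weighted_cong:
  assumes "\<And>i. i < Suc k \<Longrightarrow> u i = v i"
  shows "weighted n m j u k = weighted n m j v k"
  using assms direction_cong[of k u v \<xi> j] by (simp add: weighted_def)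

lemma continuous_combination: "continuous_on \<Omega> (\<lambda>u. \<Sum>k. weighted n m j u k)"
proof (rule continuous_on_suminf)
  show "continuous_on \<Omega> (\<lambda>u. weighted n m j u k)" for k
    by (rule continuous_on_finite_dependence[of _ "Suc k"]) (rule weighted_cong)
  show "summable (\<lambda>k. (\<bar>n\<bar> + \<bar>m\<bar>) * tail_bound k)" by (intro summable_mult summable_tail_bound)
qed (use weighted_le in auto)

definition generators :: "real set" where
  "generators = (\<Union>j. a_val j ` \<Omega> \<union> b_val j ` \<Omega>)"

lemma fsigma_generators: "fsigma generators"
  unfolding generators_def
proof (rule fsigma_UN_compact)
  fix j
  have "continuous_on \<Omega> (a_val j)" "continuous_on \<Omega> (b_val j)"
    using continuous_combination by (simp_all add: a_val_def[abs_def] b_val_def[abs_def])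
  then show "compact (a_val j ` \<Omega> \<union> b_val j ` \<Omega>)"
    by (intro compact_Un compact_continuous_image compact_digit_seqs)
qed

lemma represents_unit_interval:
  assumes "0 \<le> t" "t < 1"
  obtains u where "u \<in> \<Omega>" "a_val j u + \<xi> j * b_val j u = t"
proof -
  obtain u where u: "u \<in> \<Omega>" "(\<lambda>i. real (u i) / real (radix M (Suc i))) sums t"
    using mixed_radix_expansion[of M t] M_ge2 assms by blast
  have "weighted 1 (\<xi> j) j u = (\<lambda>i. real (u i) / real (radix M (Suc i)))"
    using direction_normalised[of \<xi> j] irrational by (simp add: weighted_def fun_eq_iff)
  then have "a_val j u + \<xi> j * b_val j u = t"
    using combination_sums[OF u(1), of 1 "\<xi> j" j] u(2) sums_unique2 by fastforce
  then show ?thesis using that u(1) by blast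
qed

text \<open>
  An arbitrary real number is an integer multiple of a number in the unit interval, and \<open>A\<close> absorbs the
  integer factor.
\<close>

lemma X_set_generators:
  assumes A: "rat_real.subspace A" "generators \<subseteq> A"
  shows "\<xi> j \<in> X_set A"
proof -
  have "\<exists>a\<in>A. \<exists>b\<in>A. t = a + \<xi> j * b" for t :: real
  proof -
    define N where "N = \<lfloor>\<bar>t\<bar>\<rfloor> + 1"
    have N: "\<bar>t\<bar> < real_of_int N" "0 < real_of_int N" unfolding N_def by linarith+
    obtain u where u: "u \<in> \<Omega>" "a_val j u + \<xi> j * b_val j u = \<bar>t\<bar> / real_of_int N"
      using represents_unit_interval[of "\<bar>t\<bar> / real_of_int N" j] N by auto
    define q :: rat where "q = (if t < 0 then - of_int N else of_int N)"
    have "a_val j u \<in> A" "b_val j u \<in> A" using A(2) u(1) by (auto simp: generators_def)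
    then have "of_rat q * a_val j u \<in> A" "of_rat q * b_val j u \<in> A"
      using A(1) by (auto intro: rat_real.subspace_scale)
    moreover have "t = of_rat q * (a_val j u + \<xi> j * b_val j u)"
      using N unfolding u(2) by (simp add: q_def of_rat_minus)
    then have "t = of_rat q * a_val j u + \<xi> j * (of_rat q * b_val j u)"
      by (simp add: algebra_simps)
    ultimately show ?thesis by blast
  qed
  then show ?thesis unfolding X_set_def by blast
qed

fun piece :: "nat \<Rightarrow> entry list \<Rightarrow> real set" where
  "piece L [] = {0}"
| "piece L (((j, \<sigma>), (n, m)) # w) = {x + y | x y.
     x \<in> {of_rat n * a_val j u + of_rat m * b_val j u | u. u \<in> \<Omega> \<and> map u [0..<L] = \<sigma>} \<and> y \<in> piece L w}"

fun total_weight :: "entry list \<Rightarrow> real" where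
  "total_weight [] = 0"
| "total_weight ((_, (n, m)) # w) = \<bar>of_rat n\<bar> + \<bar>of_rat m\<bar> + total_weight w"

lemma total_weight_nonneg: "0 \<le> total_weight w"
  by (induction w rule: total_weight.induct) auto

text \<open>
  Such a combination is determined up to the tail by the first \<open>k\<close> digits, which take \<open>radix M k\<close> values.
\<close>

lemma killed_term_covered:
  assumes U: "\<And>u. u \<in> U \<Longrightarrow> u \<in> \<Omega> \<and> n * fst (direction \<xi> k j u) + m * snd (direction \<xi> k j u) = 0"
  shows "covered_by {n * a_val j u + m * b_val j u | u. u \<in> U} (radix M k) ((\<bar>n\<bar> + \<bar>m\<bar>) * \<tau> k)"
proof -
  define head where "head u = (\<Sum>l<k. weighted n m j u l)" for u
  have cong: "head u = head v" if "\<And>i. i < k \<Longrightarrow> u i = v i" for u v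
    unfolding head_def using that by (intro sum.cong refl weighted_cong) auto
  have "U \<subseteq> \<Omega>" using U by blast
  from finite_prefix_values[OF this, of k head] cong
  have "finite (head ` U)" "card (head ` U) \<le> radix M k" by blast+
  moreover have "\<bar>(n * a_val j u + m * b_val j u) - head u\<bar> \<le> (\<bar>n\<bar> + \<bar>m\<bar>) * \<tau> k" if "u \<in> U" for u
    unfolding head_def using U[OF that] by (intro combination_near_head) auto
  ultimately show ?thesis unfolding covered_by_def by (intro exI[of _ "head ` U"]) blast
qed

text \<open>
  The table \<open>w\<close> itself is the current pattern, so stage \<open>k\<close> is killed in every term at once. Distinctness of the keys
  makes the lookup return the right entry; the induction runs over sublists \<open>w'\<close> while the pattern stays fixed.
\<close>

lemma piece_covered:
  assumes p: "pattern k = (L, w)" "L \<le> k" and d: "distinct (map fst w)" and "set w' \<subseteq> set w"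
  shows "covered_by (piece L w') (radix M k ^ length w') (total_weight w' * \<tau> k)"
  using assms(4)
proof (induction w')
  case Nil
  show ?case unfolding covered_by_def by (intro exI[of _ "{0}"]) auto
next
  case (Cons e w')
  obtain j \<sigma> n m where e: "e = ((j, \<sigma>), (n, m))" by (metis surj_pair)
  have look: "map_of w (j, \<sigma>) = Some (n, m)" using d Cons.prems e by simp
  have "covered_by {of_rat n * a_val j u + of_rat m * b_val j u | u. u \<in> {u \<in> \<Omega>. map u [0..<L] = \<sigma>}}
      (radix M k) ((\<bar>of_rat n\<bar> + \<bar>of_rat m\<bar>) * \<tau> k)"
    using direction_annihilates[OF p] look by (intro killed_term_covered) blast
  from covered_by_sumset[OF this Cons.IH] show ?case
    using Cons.prems by (simp add: e distrib_right)
qed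

lemma prefixes_separate:
  assumes "finite (S :: (nat \<Rightarrow> nat) set)"
  obtains L where "inj_on (\<lambda>u. map u [0..<L]) S"
proof -
  have "\<exists>L. inj_on (\<lambda>u. map u [0..<L]) S"
    using assms
  proof (induction S)
    case (insert u S)
    then obtain L where L: "inj_on (\<lambda>u. map u [0..<L]) S" by auto
    have "\<forall>v\<in>S. \<exists>i. u i \<noteq> v i" using insert by (metis ext)
    then obtain f where f: "\<And>v. v \<in> S \<Longrightarrow> u (f v) \<noteq> v (f v)" by metis
    \<comment> \<open>Inserting \<open>0\<close> keeps the maximum meaningful for empty \<open>S\<close>.\<close>
    define L' where "L' = max L (Suc (Max (insert 0 (f ` S))))"
    have fL: "f v < L'" if "v \<in> S" for v
      using that insert(1) Max_ge[of "insert 0 (f ` S)" "f v"] by (simp add: L'_def less_max_iff_disj less_Suc_eq_le)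
    have "inj_on (\<lambda>u. map u [0..<L']) S"
    proof (rule inj_onI)
      fix v v' assume "v \<in> S" "v' \<in> S" "map v [0..<L'] = map v' [0..<L']"
      moreover from this(3) have "map v [0..<L] = map v' [0..<L]" by (simp add: L'_def)
      ultimately show "v = v'" using L by (auto dest: inj_onD)
    qed
    moreover have "map u [0..<L'] \<noteq> map v [0..<L']" if "v \<in> S" for v
      using f[OF that] fL[OF that] by auto
    ultimately have "inj_on (\<lambda>u. map u [0..<L']) (insert u S)" unfolding inj_on_insert by blast
    then show ?case by blast
  qed simp
  then show ?thesis using that by blast
qed

text \<open>
  Generators belonging to the same pair \<open>(j, u)\<close> are collected in a single term. This is essential: a table can annihilate one vector
  \<open>(n, m)\<close> for each pair, but not two independent ones.
\<close>

lemma span_generators_combination: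
  assumes "x \<in> rat_real.span generators"
  obtains S and n m :: "nat \<times> (nat \<Rightarrow> nat) \<Rightarrow> rat" where "finite S" "snd ` S \<subseteq> \<Omega>"
    "x = (\<Sum>p\<in>S. of_rat (n p) * a_val (fst p) (snd p) + of_rat (m p) * b_val (fst p) (snd p))"
proof -
  have "\<exists>S (n :: nat \<times> (nat \<Rightarrow> nat) \<Rightarrow> rat) m. finite S \<and> snd ` S \<subseteq> \<Omega> \<and>
    x = (\<Sum>p\<in>S. of_rat (n p) * a_val (fst p) (snd p) + of_rat (m p) * b_val (fst p) (snd p))"
    using assms
  proof (induction rule: rat_real.span_induct_alt)
    case base
    show ?case by (intro exI[of _ "{}"]) auto
  next
    case (step q x y)
    obtain S and n m :: "nat \<times> (nat \<Rightarrow> nat) \<Rightarrow> rat" where S: "finite S" "snd ` S \<subseteq> \<Omega>"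
      "y = (\<Sum>p\<in>S. of_rat (n p) * a_val (fst p) (snd p) + of_rat (m p) * b_val (fst p) (snd p))"
      using step(2) by blast
    have "\<exists>j u. \<exists>\<alpha> \<beta> :: rat. u \<in> \<Omega> \<and> x = of_rat \<alpha> * a_val j u + of_rat \<beta> * b_val j u"
    proof -
      obtain j u where "u \<in> \<Omega>" "x = a_val j u \<or> x = b_val j u"
        using step(1) by (auto simp: generators_def)
      then show ?thesis
      proof (elim disjE)
        assume "x = a_val j u"
        then have "x = of_rat 1 * a_val j u + of_rat 0 * b_val j u" by simp
        then show ?thesis using \<open>u \<in> \<Omega>\<close> by blast
      next
        assume "x = b_val j u"
        then have "x = of_rat 0 * a_val j u + of_rat 1 * b_val j u" by simp
        then show ?thesis using \<open>u \<in> \<Omega>\<close> by blast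
      qed
    qed
    then obtain j u and \<alpha> \<beta> :: rat where x: "u \<in> \<Omega>" "x = of_rat \<alpha> * a_val j u + of_rat \<beta> * b_val j u"
      by blast
    define z where "z = (j, u)"
    have zz: "fst z = j" "snd z = u" by (simp_all add: z_def)
    define n' where "n' p = (if p \<in> S then n p else 0) + (if p = z then q * \<alpha> else 0)" for p
    define m' where "m' p = (if p \<in> S then m p else 0) + (if p = z then q * \<beta> else 0)" for p
    define f where "f p = of_rat (n p) * a_val (fst p) (snd p) + of_rat (m p) * b_val (fst p) (snd p)" for p
    have f': "of_rat (n' p) * a_val (fst p) (snd p) + of_rat (m' p) * b_val (fst p) (snd p) =
       (if p \<in> S then f p else 0) + (if p = z then of_rat q * x else 0)" for p
    proof -
      have n'p: "(of_rat (n' p) :: real) = (if p \<in> S then of_rat (n p) else 0) + (if p = z then of_rat q * of_rat \<alpha> else 0)"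
        by (simp add: n'_def of_rat_add of_rat_mult)
      have m'p: "(of_rat (m' p) :: real) = (if p \<in> S then of_rat (m p) else 0) + (if p = z then of_rat q * of_rat \<beta> else 0)"
        by (simp add: m'_def of_rat_add of_rat_mult)
      have qx: "of_rat q * x = of_rat q * of_rat \<alpha> * a_val (fst z) (snd z) + of_rat q * of_rat \<beta> * b_val (fst z) (snd z)"
        unfolding x(2) zz by (rule distrib_left[THEN trans]) (simp only: mult.assoc)
      show ?thesis
        unfolding n'p m'p qx f_def by (cases "p \<in> S"; cases "p = z") (simp_all only: simp_thms if_True if_False distrib_left distrib_right add_0_left add_0_right mult_zero_left ac_simps)
    qed
    have "(\<Sum>p\<in>insert z S. of_rat (n' p) * a_val (fst p) (snd p) + of_rat (m' p) * b_val (fst p) (snd p))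
      = (\<Sum>p\<in>insert z S. if p \<in> S then f p else 0) + (\<Sum>p\<in>insert z S. if p = z then of_rat q * x else 0)"
      unfolding f' by (rule sum.distrib)
    also have "(\<Sum>p\<in>insert z S. if p \<in> S then f p else 0) = (\<Sum>p\<in>S. f p)"
      by (rule sum.mono_neutral_cong_right) (use S(1) in auto)
    also have "(\<Sum>p\<in>insert z S. if p = z then of_rat q * x else 0) = of_rat q * x"
      using S(1) by simp
    finally have "of_rat q * x + y =
      (\<Sum>p\<in>insert z S. of_rat (n' p) * a_val (fst p) (snd p) + of_rat (m' p) * b_val (fst p) (snd p))"
      using S(3) by (simp add: f_def)
    then show ?case using S x(1)
      by (intro exI[of _ "insert z S"] exI[of _ n'] exI[of _ m']) (auto simp: z_def)
  qed
  then show ?thesis using that by blast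
qed

text \<open>
  A common prefix length that separates all digit sequences involved turns the combination into a table with
  distinct keys.
\<close>

lemma span_generators_piece:
  assumes "x \<in> rat_real.span generators"
  obtains L w where "distinct (map fst w)" "x \<in> piece L w"
proof -
  obtain S and n m :: "nat \<times> (nat \<Rightarrow> nat) \<Rightarrow> rat" where S: "finite S" "snd ` S \<subseteq> \<Omega>"
    "x = (\<Sum>p\<in>S. of_rat (n p) * a_val (fst p) (snd p) + of_rat (m p) * b_val (fst p) (snd p))"
    using span_generators_combination[OF assms] by blast
  obtain L where L: "inj_on (\<lambda>u. map u [0..<L]) (snd ` S)"
    using prefixes_separate[of "snd ` S"] S(1) by auto
  obtain ps where ps: "set ps = S" "distinct ps" using finite_distinct_list[OF S(1)] by blast
  define e where "e p = ((fst p, map (snd p) [0..<L]), (n p, m p))" for p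
  have "(\<Sum>p\<leftarrow>qs. of_rat (n p) * a_val (fst p) (snd p) + of_rat (m p) * b_val (fst p) (snd p))
      \<in> piece L (map e qs)" if "set qs \<subseteq> S" for qs
    using that
  proof (induction qs)
    case (Cons p qs)
    have "snd p \<in> \<Omega>" using Cons.prems S(2) by auto
    then have "of_rat (n p) * a_val (fst p) (snd p) + of_rat (m p) * b_val (fst p) (snd p)
      \<in> {of_rat (n p) * a_val (fst p) u + of_rat (m p) * b_val (fst p) u | u.
          u \<in> \<Omega> \<and> map u [0..<L] = map (snd p) [0..<L]}" by blast
    moreover have "(\<Sum>p\<leftarrow>qs. of_rat (n p) * a_val (fst p) (snd p) + of_rat (m p) * b_val (fst p) (snd p))
      \<in> piece L (map e qs)" using Cons by simp
    ultimately show ?case unfolding list.map e_def[of p] piece.simps sum_list.Cons by blast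
  qed simp
  from this[of ps] have "x \<in> piece L (map e ps)"
    using ps S(3) by (simp add: sum_list_distinct_conv_sum_set)
  moreover have "distinct (map fst (map e ps))"
  proof -
    have "inj_on (\<lambda>p. fst (e p)) S"
    proof (rule inj_onI)
      fix p q assume *: "p \<in> S" "q \<in> S" "fst (e p) = fst (e q)"
      then have "snd p = snd q" using inj_onD[OF L, of "snd p" "snd q"] by (simp add: e_def)
      then show "p = q" using * by (simp add: e_def prod_eq_iff)
    qed
    then show ?thesis using ps by (simp add: distinct_map comp_def)
  qed
  ultimately show ?thesis using that by blast
qed

text \<open>
  At a stage \<open>k\<close> with pattern \<open>(L, w)\<close>, every ball of the cover of \<open>C k\<close> is translated by the at most
  \<open>radix M k ^ length w\<close> points near which the piece lies, and enlarged by the factor \<open>1 + \<Lambda>\<close>, since \<open>\<tau> k\<close> is at most its radius.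
  The factor \<open>radix M k ^ k\<close> built into the cover pays for the translates as soon as \<open>k \<ge> length w\<close>.
\<close>

lemma hausdorff_null_piece:
  assumes cover: "\<And>k. \<exists>(I::nat set) c r. finite I \<and> (\<forall>i\<in>I. \<tau> k \<le> r i \<and> r i < 1) \<and>
       C k \<subseteq> (\<Union>i\<in>I. ball (c i) (r i)) \<and>
       (\<Sum>i\<in>I. r i powr (d + 1 / real (Suc k))) < 1 / (real (Suc k) * real (radix M k) ^ k)"
    and C_mono: "\<And>m n. m \<le> n \<Longrightarrow> C m \<subseteq> C n"
    and d: "0 \<le> d" "d < t" and w: "distinct (map fst w)"
  shows "hausdorff_null t {x + y | x y. x \<in> C n \<and> y \<in> piece L w}"
proof (rule hausdorff_null_finite_cover)
  show t0: "0 < t" using d by simp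
  fix \<epsilon> :: real assume e: "0 < \<epsilon>"
  define \<Lambda> where "\<Lambda> = total_weight w"
  have \<Lambda>: "0 \<le> \<Lambda>" by (simp add: \<Lambda>_def total_weight_nonneg)
  \<comment> \<open>Beyond \<open>K1\<close> the exponent \<open>d + 1 / (k + 1)\<close> of the cover is below \<open>t\<close>; beyond \<open>K2\<close> the final bound is below \<open>\<epsilon>\<close>.\<close>
  obtain K1 :: nat where K1: "1 / (t - d) < real K1" using reals_Archimedean2 by blast
  obtain K2 :: nat where K2: "(1 + \<Lambda>) powr t / \<epsilon> < real K2" using reals_Archimedean2 by blast
  obtain k where k: "k \<ge> Max {n, L, K1, K2, length w}" "pattern k = (L, w)"
    by (rule pattern_recurs)
  then have kk: "n \<le> k" "L \<le> k" "K1 \<le> k" "K2 \<le> k" "length w \<le> k" by auto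
  obtain I :: "nat set" and c r where I: "finite I" "\<forall>i\<in>I. \<tau> k \<le> r i \<and> r i < 1"
    "C k \<subseteq> (\<Union>i\<in>I. ball (c i) (r i))"
    "(\<Sum>i\<in>I. r i powr (d + 1 / real (Suc k))) < 1 / (real (Suc k) * real (radix M k) ^ k)"
    using cover[of k] by blast
  obtain H where H: "finite H" "card H \<le> radix M k ^ length w"
    "\<And>y. y \<in> piece L w \<Longrightarrow> \<exists>h\<in>H. \<bar>y - h\<bar> \<le> \<Lambda> * \<tau> k"
    using piece_covered[OF k(2) kk(2) w subset_refl] unfolding covered_by_def \<Lambda>_def by blast
  have rpos: "0 < r i" if "i \<in> I" for i using I(2) that \<tau>_pos[of k] by force
  define c' where "c' = (\<lambda>(i, h). c i + h)"
  define r' where "r' = (\<lambda>(i::nat, h::real). (1 + \<Lambda>) * r i)"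
  have "finite (I \<times> H)" using I H by simp
  moreover have "\<forall>p\<in>I \<times> H. 0 < r' p" using rpos \<Lambda> by (auto simp: r'_def)
  moreover have "{x + y | x y. x \<in> C n \<and> y \<in> piece L w} \<subseteq> (\<Union>p\<in>I \<times> H. ball (c' p) (r' p))"
  proof
    fix z assume "z \<in> {x + y | x y. x \<in> C n \<and> y \<in> piece L w}"
    then obtain x y where xy: "z = x + y" "x \<in> C n" "y \<in> piece L w" by blast
    have "x \<in> C k" using xy(2) C_mono[OF kk(1)] by blast
    then obtain i where i: "i \<in> I" "\<bar>c i - x\<bar> < r i" using I(3) by (auto simp: dist_real_def)
    obtain h where h: "h \<in> H" "\<bar>y - h\<bar> \<le> \<Lambda> * \<tau> k" using H(3)[OF xy(3)] by blast
    have "\<Lambda> * \<tau> k \<le> \<Lambda> * r i" using I(2) i(1) \<Lambda> by (intro mult_left_mono) auto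
    then have "\<bar>(c i + h) - z\<bar> < (1 + \<Lambda>) * r i" using i h xy(1) by (simp add: algebra_simps)
    then have "z \<in> ball (c' (i, h)) (r' (i, h))" by (simp add: c'_def r'_def dist_real_def)
    then show "z \<in> (\<Union>p\<in>I \<times> H. ball (c' p) (r' p))" using i(1) h(1) by blast
  qed
  moreover have "(\<Sum>p\<in>I \<times> H. r' p powr t) < \<epsilon>"
  proof -
    define R where "R = real (radix M k)"
    have R1: "1 \<le> R" using radix_M_pos[of k] by (simp add: R_def)
    have td: "d + 1 / real (Suc k) \<le> t"
    proof -
      have "1 / (t - d) < real (Suc k)" using K1 kk(3) by linarith
      then have "1 / real (Suc k) \<le> t - d" using d by (simp add: field_simps)
      then show ?thesis by simp
    qed
    have "(\<Sum>p\<in>I \<times> H. r' p powr t) = (\<Sum>i\<in>I. \<Sum>h\<in>H. ((1 + \<Lambda>) * r i) powr t)"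
      unfolding sum.cartesian_product by (simp add: r'_def split_def)
    also have "\<dots> = real (card H) * (\<Sum>i\<in>I. ((1 + \<Lambda>) * r i) powr t)"
      by (simp add: sum_distrib_left)
    also have "(\<Sum>i\<in>I. ((1 + \<Lambda>) * r i) powr t) = (1 + \<Lambda>) powr t * (\<Sum>i\<in>I. r i powr t)"
      using rpos \<Lambda> by (simp add: powr_mult less_imp_le sum_distrib_left)
    also have "real (card H) * ((1 + \<Lambda>) powr t * (\<Sum>i\<in>I. r i powr t))
      \<le> R ^ k * ((1 + \<Lambda>) powr t * (1 / (real (Suc k) * R ^ k)))"
    proof (intro mult_mono)
      have "real (card H) \<le> R ^ length w" using H(2) by (simp add: R_def flip: of_nat_power)
      also have "\<dots> \<le> R ^ k" using R1 kk(5) by (intro power_increasing) auto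
      finally show "real (card H) \<le> R ^ k" .
      have "(\<Sum>i\<in>I. r i powr t) \<le> (\<Sum>i\<in>I. r i powr (d + 1 / real (Suc k)))"
        using rpos I(2) td by (intro sum_mono powr_mono') (auto simp: less_imp_le)
      then show "(\<Sum>i\<in>I. r i powr t) \<le> 1 / (real (Suc k) * R ^ k)" using I(4) by (simp add: R_def)
    qed (use R1 in \<open>auto intro!: sum_nonneg mult_nonneg_nonneg\<close>)
    also have "\<dots> = (1 + \<Lambda>) powr t / real (Suc k)" using R1 by simp
    also have "\<dots> < \<epsilon>"
    proof -
      have "(1 + \<Lambda>) powr t / \<epsilon> < real (Suc k)" using K2 kk(4) by linarith
      then show ?thesis using e by (simp add: field_simps)
    qed
    finally show ?thesis .
  qed
  ultimately show "\<exists>(J::(nat \<times> real) set) c r. finite J \<and> (\<forall>i\<in>J. 0 < r i) \<and>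
      {x + y | x y. x \<in> C n \<and> y \<in> piece L w} \<subseteq> (\<Union>i\<in>J. ball (c i) (r i)) \<and> (\<Sum>i\<in>J. r i powr t) < \<epsilon>"
    by (intro exI[of _ "I \<times> H"] exI[of _ c'] exI[of _ r'] conjI)
qed

end

section \<open>Choice of scales and the extension theorem\<close>

text \<open>
  Compactness makes the cover finite, so its radii have a positive minimum, which serves as the scale.
\<close>

lemma scale_below_cover:
  assumes "compact C" "hausdorff_null s C" "0 < s" "0 < \<epsilon>"
  shows "\<exists>\<tau>0>0. \<forall>\<tau>\<le>\<tau>0. \<exists>(I::nat set) c r. finite I \<and> (\<forall>i\<in>I. \<tau> \<le> r i \<and> r i < 1) \<and>
    C \<subseteq> (\<Union>i\<in>I. ball (c i) (r i)) \<and> (\<Sum>i\<in>I. r i powr s) < \<epsilon>"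
proof -
  obtain I :: "nat set" and c r where I: "finite I" "\<And>i. 0 < r i" "\<And>i. r i < 1"
    "C \<subseteq> (\<Union>i\<in>I. ball (c i) (r i))" "(\<Sum>i\<in>I. r i powr s) < \<epsilon>"
    by (rule hausdorff_null_compact_cover[OF assms(2,1,3,4)]) (rule that)
  \<comment> \<open>The value \<open>1\<close> takes care of an empty cover.\<close>
  define \<tau>0 where "\<tau>0 = Min (insert 1 (r ` I))"
  have "0 < \<tau>0" unfolding \<tau>0_def using I(1,2) by (subst Min_gr_iff) auto
  moreover have "\<tau>0 \<le> r i" if "i \<in> I" for i unfolding \<tau>0_def using I(1) that by (intro Min_le) auto
  then have "\<forall>i\<in>I. \<tau> \<le> r i \<and> r i < 1" if "\<tau> \<le> \<tau>0" for \<tau> using that I(3) by (meson order_trans)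
  ultimately show ?thesis using I(1,4,5) by blast
qed

text \<open>
  The state of the recursion is the pair of \<open>radix M k\<close> and \<open>\<tau> k\<close>: the cover, and with it \<open>\<tau> k\<close>, depends on the
  radices before \<open>k\<close> only, and the radix \<open>M k\<close> is chosen after \<open>\<tau> k\<close>.
\<close>

lemma adapted_scales:
  assumes C: "\<And>k. compact (C k)" "\<And>k s. d < s \<Longrightarrow> hausdorff_null s (C k)" and d: "0 \<le> d"
  obtains M \<tau> where "\<And>i. 2 \<le> M i" "\<And>k. 0 < \<tau> k"
    "\<And>k. V (Suc k) / real (radix M (Suc k)) \<le> \<tau> k / 2" "\<And>k. \<tau> (Suc k) \<le> \<tau> k / 2"
    "\<And>k. \<exists>(I::nat set) c r. finite I \<and> (\<forall>i\<in>I. \<tau> k \<le> r i \<and> r i < 1) \<and>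
       C k \<subseteq> (\<Union>i\<in>I. ball (c i) (r i)) \<and>
       (\<Sum>i\<in>I. r i powr (d + 1 / real (Suc k))) < 1 / (real (Suc k) * real (radix M k) ^ k)"
proof -
  define good where "good k R \<tau> \<longleftrightarrow> (\<exists>(I::nat set) c r. finite I \<and> (\<forall>i\<in>I. \<tau> \<le> r i \<and> r i < 1) \<and>
       C k \<subseteq> (\<Union>i\<in>I. ball (c i) (r i)) \<and>
       (\<Sum>i\<in>I. r i powr (d + 1 / real (Suc k))) < 1 / (real (Suc k) * real R ^ k))" for k R \<tau>
  have ex_good: "\<exists>\<tau>0>0. \<forall>\<tau>\<le>\<tau>0. good k R \<tau>" if "0 < R" for k R
    unfolding good_def using that d by (intro scale_below_cover C) (auto intro: add_nonneg_pos)
  define P where "P k s \<longleftrightarrow> (0::nat) < fst s \<and> 0 < snd s \<and> good k (fst s) (snd s) \<and> (k = 0 \<longrightarrow> fst s = 1)" for k s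
  define Q where "Q k s s' \<longleftrightarrow> (\<exists>m\<ge>2. fst s' = fst s * m) \<and> V (Suc k) / real (fst s') \<le> snd s / 2 \<and> snd s' \<le> snd s / 2"
    for k and s s' :: "nat \<times> real"
  have "\<exists>f. \<forall>k. P k (f k) \<and> Q k (f k) (f (Suc k))"
  proof (rule dependent_nat_choice)
    obtain \<tau>0 where "0 < \<tau>0" "good 0 1 \<tau>0" using ex_good[of 1 0] by auto
    then show "\<exists>s. P 0 s" by (intro exI[of _ "(1, \<tau>0)"]) (simp add: P_def)
  next
    fix s k assume s: "P k s"
    obtain R \<tau> where st: "s = (R, \<tau>)" by fastforce
    have R: "0 < R" and \<tau>: "0 < \<tau>" using s by (auto simp: P_def st)
    obtain m :: nat where m: "max 2 (2 * \<bar>V (Suc k)\<bar> / \<tau>) < real m" using reals_Archimedean2 by blast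
    then have m2: "2 \<le> m" by simp
    have "0 < R * m" using R m2 by simp
    then obtain \<tau>0 where \<tau>0: "0 < \<tau>0" "\<And>t. t \<le> \<tau>0 \<Longrightarrow> good (Suc k) (R * m) t"
      using ex_good[of "R * m" "Suc k"] by blast
    define \<tau>' where "\<tau>' = min \<tau>0 (\<tau> / 2)"
    have "V (Suc k) / real (R * m) \<le> \<tau> / 2"
    proof -
      have "2 * \<bar>V (Suc k)\<bar> < \<tau> * real m" using m \<tau> by (simp add: field_simps)
      also have "\<dots> \<le> \<tau> * (real R * real m)" using \<tau> R mult_right_mono[of 1 "real R" "real m"] by (intro mult_left_mono) auto
      finally have "2 * V (Suc k) \<le> \<tau> * real (R * m)" by simp
      then show ?thesis using \<open>0 < R * m\<close> by (simp add: field_simps)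
    qed
    then have "Q k s (R * m, \<tau>')" using m2 by (auto simp: Q_def st \<tau>'_def)
    moreover have "P (Suc k) (R * m, \<tau>')" using \<open>0 < R * m\<close> \<tau>0 \<tau> by (simp add: P_def \<tau>'_def)
    ultimately show "\<exists>s'. P (Suc k) s' \<and> Q k s s'" by blast
  qed
  then obtain f where f: "\<And>k. P k (f k)" "\<And>k. Q k (f k) (f (Suc k))" by blast
  have "\<forall>k. \<exists>m\<ge>2. fst (f (Suc k)) = fst (f k) * m" using f(2) by (simp add: Q_def)
  then obtain M where M: "\<And>k. 2 \<le> M k" "\<And>k. fst (f (Suc k)) = fst (f k) * M k" by metis
  have R: "fst (f k) = radix M k" for k
    by (induction k) (use f(1)[of 0] in \<open>simp_all add: P_def M(2) radix_Suc\<close>)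
  show ?thesis
  proof (rule that[of M "\<lambda>k. snd (f k)"])
    show "0 < snd (f k)" for k using f(1)[of k] by (simp add: P_def)
    show "V (Suc k) / real (radix M (Suc k)) \<le> snd (f k) / 2" "snd (f (Suc k)) \<le> snd (f k) / 2" for k
      using f(2)[of k] by (simp_all add: Q_def R)
    show "\<exists>(I::nat set) c r. finite I \<and> (\<forall>i\<in>I. snd (f k) \<le> r i \<and> r i < 1) \<and>
       C k \<subseteq> (\<Union>i\<in>I. ball (c i) (r i)) \<and>
       (\<Sum>i\<in>I. r i powr (d + 1 / real (Suc k))) < 1 / (real (Suc k) * real (radix M k) ^ k)" for k
      using f(1)[of k] by (simp only: P_def R good_def)
  qed (rule M(1))
qed

lemma subspace_extension:
  assumes B: "fsigma B" "rat_real.subspace B" "\<And>t. d < t \<Longrightarrow> hausdorff_null t B" and d: "0 \<le> d"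
    and \<xi>: "\<And>j::nat. \<xi> j \<notin> \<rat>"
  obtains A where "fsigma A" "rat_real.subspace A" "B \<subseteq> A" "\<And>t. d < t \<Longrightarrow> hausdorff_null t A"
    "\<And>j. \<xi> j \<in> X_set A"
proof -
  obtain C :: "nat \<Rightarrow> real set" where C: "\<And>n. compact (C n)" "\<And>m n. m \<le> n \<Longrightarrow> C m \<subseteq> C n" "B = (\<Union>n. C n)"
    by (rule fsigma_compact_exhaustion[OF B(1)]) (rule that)
  have Cnull: "hausdorff_null s (C k)" if "d < s" for k s
    using B(3)[OF that] C(3) by (intro hausdorff_null_subset[of s B "C k"]) auto
  obtain V where V: "\<And>k j u. \<bar>fst (direction \<xi> k j u)\<bar> \<le> V k" "\<And>k j u. \<bar>snd (direction \<xi> k j u)\<bar> \<le> V k"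
    using direction_bounded[of \<xi>] by metis
  obtain M \<tau> where M: "\<And>i. 2 \<le> M i" "\<And>k. 0 < \<tau> k"
    "\<And>k. V (Suc k) / real (radix M (Suc k)) \<le> \<tau> k / 2" "\<And>k. \<tau> (Suc k) \<le> \<tau> k / 2"
    and cover: "\<And>k. \<exists>(I::nat set) c r. finite I \<and> (\<forall>i\<in>I. \<tau> k \<le> r i \<and> r i < 1) \<and>
       C k \<subseteq> (\<Union>i\<in>I. ball (c i) (r i)) \<and>
       (\<Sum>i\<in>I. r i powr (d + 1 / real (Suc k))) < 1 / (real (Suc k) * real (radix M k) ^ k)"
    by (rule adapted_scales[of C d V, OF C(1) Cnull d]) (assumption, rule that)
  interpret steered_digits \<xi> M V \<tau>
    by unfold_locales (use \<xi> V M in auto)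
  define A where "A = rat_real.span (B \<union> generators)"
  show ?thesis
  proof (rule that[of A])
    show "fsigma A" unfolding A_def by (intro fsigma_rat_span fsigma_Un B(1) fsigma_generators)
    show sub: "rat_real.subspace A" unfolding A_def by (rule rat_real.subspace_span)
    show "B \<subseteq> A" unfolding A_def using rat_real.span_superset by blast
    show "\<xi> j \<in> X_set A" for j
    proof (rule X_set_generators[OF sub])
      show "generators \<subseteq> A" unfolding A_def using rat_real.span_superset by blast
    qed
    show "hausdorff_null t A" if t: "d < t" for t
    proof (rule hausdorff_null_subset)
      define E where "E = (\<lambda>(n, L, w). if distinct (map fst w) then {x + y | x y. x \<in> C n \<and> y \<in> piece L w} else {})"
      have "hausdorff_null t (E p)" for p
      proof -
        obtain n L w where p: "p = (n, L, w)" by (metis surj_pair)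
        have "hausdorff_null t {x + y | x y. x \<in> C n \<and> y \<in> piece L w}" if "distinct (map fst w)"
          using cover C(2) d t that by (rule hausdorff_null_piece)
        moreover have "hausdorff_null t {}" using Cnull[OF t] by (rule hausdorff_null_subset) simp
        ultimately show ?thesis by (simp add: E_def p)
      qed
      then show "hausdorff_null t (\<Union>p. E p)" by (rule hausdorff_null_UN_countable)
      show "A \<subseteq> (\<Union>p. E p)"
      proof
        fix z assume "z \<in> A"
        then obtain x y where xy: "z = x + y" "x \<in> rat_real.span B" "y \<in> rat_real.span generators"
          unfolding A_def rat_real.span_Un by blast
        have "x \<in> B" using xy(2) B(2) by (simp add: rat_real.span_eq_iff[THEN iffD2])
        then obtain n where "x \<in> C n" using C(3) by blast
        moreover obtain L w where "distinct (map fst w)" "y \<in> piece L w"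
          using span_generators_piece[OF xy(3)] .
        ultimately have "z \<in> E (n, L, w)" using xy(1) by (auto simp: E_def)
        then show "z \<in> (\<Union>p. E p)" by blast
      qed
    qed
  qed
qed

text \<open>
  The irrationals to be treated are enumerated; an irrational \<open>\<theta>\<close> is added since \<open>D\<close> may be empty. Passing first to the rational
  span of \<open>B\<close> preserves null sets. Should the dimension of \<open>B\<close> be infinite, the whole line has the required dimension.
\<close>

lemma subgroup_extension:
  assumes B: "fsigma (B :: real set)" "add_subgroup B" and D: "countable D" "D \<subseteq> UNIV - \<rat>"
  obtains A where "fsigma A" "rat_real.subspace A" "B \<subseteq> A" "hausdorff_dim A = hausdorff_dim B" "D \<subseteq> X_set A"
proof -
  define S where "S = rat_real.span B"
  have S: "fsigma S" "rat_real.subspace S" "B \<subseteq> S"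
    unfolding S_def using B(1) by (auto intro: fsigma_rat_span rat_real.subspace_span rat_real.span_base)
  obtain \<theta> :: real where "\<theta> \<notin> \<rat>" using countable_rat uncountable_UNIV_real by (metis UNIV_eq_I)
  define \<xi> where "\<xi> = from_nat_into (insert \<theta> D)"
  have "countable (insert \<theta> D)" using D by simp
  then have rng: "range \<xi> = insert \<theta> D" unfolding \<xi>_def by (intro range_from_nat_into) auto
  have \<xi>: "\<xi> j \<notin> \<rat>" for j
  proof -
    have "\<xi> j \<in> insert \<theta> D" using rng by (metis rangeI)
    then show ?thesis using D(2) \<open>\<theta> \<notin> \<rat>\<close> by auto
  qed
  show ?thesis
  proof (cases "hausdorff_dim B")
    case (real d)
    have null: "hausdorff_null t B" if "d < t" for t
      using hausdorff_dim_le_iff[of d B] real that by simp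
    then have "hausdorff_null t S" if "d < t" for t
      unfolding S_def using that by (intro hausdorff_null_rat_span B(2))
    then obtain A where A: "fsigma A" "rat_real.subspace A" "S \<subseteq> A" "\<And>t. d < t \<Longrightarrow> hausdorff_null t A" "\<And>j. \<xi> j \<in> X_set A"
      using subspace_extension[of S d \<xi>, OF S(1,2) _ _ \<xi>] real by metis
    have "hausdorff_dim A \<le> hausdorff_dim B"
      using hausdorff_dim_le_iff[of d A] real A(4) by simp
    moreover have "hausdorff_dim B \<le> hausdorff_dim A" using A(3) S(3) by (intro hausdorff_dim_mono) simp
    moreover have "range \<xi> \<subseteq> X_set A" using A(5) by (rule image_subsetI)
    then have "D \<subseteq> X_set A" using rng by simp
    ultimately show ?thesis using A S(3) by (intro that[of A]) auto
  next
    case top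
    have "hausdorff_dim B \<le> hausdorff_dim (UNIV :: real set)" by (rule hausdorff_dim_mono) simp
    then have "hausdorff_dim (UNIV :: real set) = hausdorff_dim B" using top by (simp add: top_unique)
    moreover have "x \<in> X_set UNIV" for x
    proof -
      have "t = t + x * 0" for t by simp
      then show ?thesis unfolding X_set_def by blast
    qed
    ultimately show ?thesis by (intro that[of UNIV]) auto
  qed
qed

section \<open>Subgroups of prescribed dimension\<close>

lemma geometric_tail:
  fixes f q :: "nat \<Rightarrow> real"
  assumes f: "\<And>k. \<bar>f k\<bar> \<le> 1 / q k" and q: "\<And>k. 0 < q k" "\<And>k. 2 * q k \<le> q (Suc k)"
  shows "summable f" "\<bar>\<Sum>i. f (i + k)\<bar> \<le> 2 / q k"
proof -
  have qk: "q k * 2 ^ i \<le> q (i + k)" for i k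
  proof (induction i)
    case (Suc i)
    then show ?case using q(2)[of "i + k"] by simp
  qed simp
  have le: "norm (f (i + k)) \<le> (1 / q k) * (1/2)^i" for i k
  proof -
    have "norm (f (i + k)) \<le> 1 / q (i + k)" using f by simp
    also have "\<dots> \<le> 1 / (q k * 2 ^ i)" using qk[of k i] q(1)[of k] by (intro divide_left_mono) (auto intro!: mult_pos_pos simp: q(1))
    finally show ?thesis by (simp add: power_divide)
  qed
  have geo: "(\<lambda>i. (1 / q k) * (1/2::real)^i) sums ((1 / q k) * 2)" for k
    using sums_mult[OF geometric_sums[of "1/2::real"], of "1 / q k"] by simp
  have "summable (\<lambda>i. (1 / q 0) * (1/2::real)^i)" using geo[of 0] by (simp add: sums_iff)
  then show "summable f"
    by (rule summable_comparison_test') (use le[of _ 0] in simp)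
  have "norm (\<Sum>i. f (i + k)) \<le> (\<Sum>i. (1 / q k) * (1/2)^i)"
  proof (rule norm_suminf_le)
    show "norm (f (i + k)) \<le> (1 / q k) * (1/2)^i" for i by (rule le)
    show "summable (\<lambda>i. (1 / q k) * (1/2::real)^i)" using geo[of k] by (simp add: sums_iff)
  qed
  also have "\<dots> = 2 / q k" using geo[of k] by (simp add: sums_iff)
  finally show "\<bar>\<Sum>i. f (i + k)\<bar> \<le> 2 / q k" by simp
qed

text \<open>
  Here \<open>\<alpha> = 1 / d\<close>, where \<open>d\<close> is the dimension to be realised. The \<open>k\<close>-th digit has the step \<open>1 / (M k * S k)\<close>, where \<open>S k = radix M k powr \<alpha>\<close>;
  the gap between this step and the next scale \<open>1 / S (k+1)\<close> is a factor \<open>M k powr (\<alpha> - 1)\<close>. The growth condition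
  makes everything before stage \<open>k\<close> negligible against \<open>M k\<close>, even after raising it to a fixed power.
\<close>

locale sparse_digits =
  fixes \<alpha> :: real and M :: "nat \<Rightarrow> nat"
  assumes \<alpha>: "1 < \<alpha>" and M_ge2: "2 \<le> M k"
    and M_gap: "4 \<le> real (M k) powr (\<alpha> - 1)"
    and M_growth: "radix M k ^ (k * k) \<le> M k"
begin

abbreviation \<Omega> :: "(nat \<Rightarrow> nat) set" where "\<Omega> \<equiv> digit_seqs M"

definition S :: "nat \<Rightarrow> real" where "S k = real (radix M k) powr \<alpha>"

lemma radix_M_pos: "0 < radix M k" using radix_pos[of M k] M_ge2 by simp

lemma M_pos: "0 < M k" using M_ge2[of k] by linarith

lemma S_pos: "0 < S k" using radix_M_pos by (simp add: S_def)

lemma S_Suc: "S (Suc k) = S k * real (M k) powr \<alpha>"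
  by (simp add: S_def radix_Suc powr_mult)

lemma S_gap: "4 * (real (M k) * S k) \<le> S (Suc k)"
proof -
  have "real (M k) powr \<alpha> = real (M k) * real (M k) powr (\<alpha> - 1)"
    using M_pos[of k] by (simp add: powr_diff)
  moreover have "real (M k) * 4 \<le> real (M k) * real (M k) powr (\<alpha> - 1)"
    using M_gap by (intro mult_left_mono) auto
  ultimately have "S k * (4 * real (M k)) \<le> S k * real (M k) powr \<alpha>"
    using S_pos[of k] by (intro mult_left_mono) auto
  then show ?thesis by (simp add: S_Suc algebra_simps)
qed

lemma S_doubles: "2 * S k \<le> S (Suc k)"
proof -
  have "1 * S k \<le> real (M k) * S k" using S_pos[of k] M_pos[of k] by (intro mult_right_mono) auto
  then show ?thesis using S_gap[of k] S_pos[of k] by linarith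
qed

lemma radix_doubles: "2 * real (radix M k) \<le> real (radix M (Suc k))"
proof -
  have "2 * radix M k \<le> radix M (Suc k)" using M_ge2[of k] by (simp add: radix_Suc mult.commute)
  then show ?thesis by linarith
qed

definition x_term :: "(nat \<Rightarrow> nat) \<Rightarrow> nat \<Rightarrow> real" where "x_term u k = real (u k) / (real (M k) * S k)"
definition y_term :: "(nat \<Rightarrow> nat) \<Rightarrow> nat \<Rightarrow> real" where "y_term u k = real (u k) / real (radix M (Suc k))"
definition x_val :: "(nat \<Rightarrow> nat) \<Rightarrow> real" where "x_val u = (\<Sum>k. x_term u k)"
definition y_val :: "(nat \<Rightarrow> nat) \<Rightarrow> real" where "y_val u = (\<Sum>k. y_term u k)"

lemma x_term_bounds: "u \<in> \<Omega> \<Longrightarrow> 0 \<le> x_term u k \<and> x_term u k \<le> 1 / S k"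
proof -
  assume u: "u \<in> \<Omega>"
  have "real (u k) / (real (M k) * S k) \<le> real (M k) / (real (M k) * S k)"
    using digit_seqs_less[OF u, of k] S_pos[of k] by (intro divide_right_mono) auto
  then show ?thesis using M_pos[of k] S_pos[of k] by (simp add: x_term_def)
qed

lemma y_term_bounds: "u \<in> \<Omega> \<Longrightarrow> 0 \<le> y_term u k \<and> y_term u k \<le> 1 / real (radix M k)"
proof -
  assume u: "u \<in> \<Omega>"
  have "real (u k) / real (radix M (Suc k)) \<le> real (M k) / real (radix M (Suc k))"
    using digit_seqs_less[OF u, of k] by (intro divide_right_mono) auto
  then show ?thesis using M_pos[of k] by (simp add: y_term_def radix_Suc)
qed

lemma summable_x: "u \<in> \<Omega> \<Longrightarrow> summable (x_term u)"
  using x_term_bounds S_pos S_doubles by (intro geometric_tail(1)[where q = S]) auto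

lemma summable_y: "u \<in> \<Omega> \<Longrightarrow> summable (y_term u)"
  using y_term_bounds radix_M_pos radix_doubles by (intro geometric_tail(1)[where q = "\<lambda>k. real (radix M k)"]) auto

lemma x_val_tail:
  assumes "u \<in> \<Omega>"
  shows "\<bar>x_val u - (\<Sum>i<Suc k. x_term u i)\<bar> \<le> 2 / S (Suc k)"
proof -
  have "x_val u = (\<Sum>i. x_term u (i + Suc k)) + (\<Sum>i<Suc k. x_term u i)"
    unfolding x_val_def by (rule suminf_split_initial_segment[OF summable_x[OF assms]])
  moreover have "\<bar>\<Sum>i. x_term u (i + Suc k)\<bar> \<le> 2 / S (Suc k)"
    using x_term_bounds[OF assms] S_pos S_doubles by (intro geometric_tail(2)) auto
  ultimately show ?thesis by simp
qed

text \<open>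
  Two expansions that agree before \<open>k\<close> differ by their \<open>k\<close>-th terms up to a geometrically decreasing tail.
\<close>

lemma first_difference_split:
  fixes f g :: "nat \<Rightarrow> real"
  assumes "summable f" "summable g" "\<And>i. i < k \<Longrightarrow> f i = g i"
    and "\<And>i. \<bar>f i - g i\<bar> \<le> 1 / q i" "\<And>i. 0 < q i" "\<And>i. 2 * q i \<le> q (Suc i)"
  shows "\<bar>((\<Sum>i. f i) - (\<Sum>i. g i)) - (f k - g k)\<bar> \<le> 2 / q (Suc k)"
proof -
  have "(\<Sum>i. f i) - (\<Sum>i. g i) = (\<Sum>i. f i - g i)" by (rule suminf_diff[OF assms(1,2)])
  also have "\<dots> = (\<Sum>i. f (i + Suc k) - g (i + Suc k)) + (\<Sum>i<Suc k. f i - g i)"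
    by (rule suminf_split_initial_segment[OF summable_diff[OF assms(1,2)]])
  also have "(\<Sum>i<Suc k. f i - g i) = f k - g k" using assms(3) by simp
  finally show ?thesis
    using geometric_tail(2)[of "\<lambda>i. f i - g i" q "Suc k"] assms(4-6) by simp
qed

text \<open>
  Let \<open>k\<close> be the first place where the digits differ, by \<open>j\<close>, and let \<open>R = radix M k\<close>. Because of the gap after stage \<open>k\<close> the values of \<open>x_val\<close> differ by at
  least \<open>j / (2 * M k * S k)\<close>, those of \<open>y_val\<close> by at most \<open>3 * j / (R * M k)\<close>. Since \<open>S k powr (1 / \<alpha>) = R\<close>, the
  former bound to the power \<open>1 / \<alpha>\<close> is \<open>(j / (2 * M k)) powr (1 / \<alpha>) / R\<close>, and the power only increases the number
  \<open>j / (2 * M k) \<le> 1\<close>.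
\<close>

lemma y_hoelder_x:
  assumes u: "u \<in> \<Omega>" and v: "v \<in> \<Omega>"
  shows "\<bar>y_val u - y_val v\<bar> \<le> 6 * \<bar>x_val u - x_val v\<bar> powr (1 / \<alpha>)"
proof (cases "u = v")
  case False
  then have "\<exists>k. u k \<noteq> v k" by auto
  define k where "k = (LEAST k. u k \<noteq> v k)"
  have k: "u k \<noteq> v k" unfolding k_def by (rule LeastI_ex) fact
  have eq: "u i = v i" if "i < k" for i using not_less_Least[of i "\<lambda>k. u k \<noteq> v k"] that by (auto simp: k_def)
  have x_eq: "x_term u i = x_term v i" and y_eq: "y_term u i = y_term v i" if "i < k" for i
    using eq[OF that] by (simp_all add: x_term_def y_term_def)
  define j where "j = \<bar>real (u k) - real (v k)\<bar>"
  have j1: "1 \<le> j" using k unfolding j_def by linarith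
  have jM: "j \<le> real (M k)" using digit_seqs_less[OF u, of k] digit_seqs_less[OF v, of k] unfolding j_def by linarith
  define R where "R = real (radix M k)"
  have R: "0 < R" using radix_M_pos by (simp add: R_def)
  have Mk: "0 < real (M k)" using M_pos by simp
  have y: "\<bar>y_val u - y_val v\<bar> \<le> 3 * j / (R * real (M k))"
  proof -
    have "\<bar>(y_val u - y_val v) - (y_term u k - y_term v k)\<bar> \<le> 2 / real (radix M (Suc k))"
      unfolding y_val_def
    proof (rule first_difference_split)
      show "\<bar>y_term u i - y_term v i\<bar> \<le> 1 / real (radix M i)" for i
        using y_term_bounds[OF u, of i] y_term_bounds[OF v, of i] by linarith
    qed (use summable_y u v y_eq radix_M_pos radix_doubles in auto)
    moreover have "\<bar>y_term u k - y_term v k\<bar> = j / real (radix M (Suc k))"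
      by (simp add: y_term_def j_def diff_divide_distrib[symmetric])
    ultimately have "\<bar>y_val u - y_val v\<bar> \<le> j / real (radix M (Suc k)) + 2 / real (radix M (Suc k))" by linarith
    also have "\<dots> = (j + 2) / real (radix M (Suc k))" by (simp add: add_divide_distrib)
    also have "\<dots> \<le> 3 * j / real (radix M (Suc k))" using j1 by (intro divide_right_mono) auto
    finally show ?thesis by (simp add: radix_Suc R_def)
  qed
  have x: "j / (2 * (real (M k) * S k)) \<le> \<bar>x_val u - x_val v\<bar>"
  proof -
    have "\<bar>(x_val u - x_val v) - (x_term u k - x_term v k)\<bar> \<le> 2 / S (Suc k)"
      unfolding x_val_def
    proof (rule first_difference_split)
      show "\<bar>x_term u i - x_term v i\<bar> \<le> 1 / S i" for i
        using x_term_bounds[OF u, of i] x_term_bounds[OF v, of i] by linarith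
    qed (use summable_x u v x_eq S_pos S_doubles in auto)
    moreover have "2 / S (Suc k) \<le> 2 / (4 * (real (M k) * S k))"
      using S_gap[of k] S_pos[of k] S_pos[of "Suc k"] Mk by (intro divide_left_mono) auto
    moreover define h where "h = j / (2 * (real (M k) * S k))"
    moreover have "2 / (4 * (real (M k) * S k)) \<le> h"
      using j1 S_pos[of k] Mk by (simp add: h_def field_simps)
    moreover have "\<bar>x_term u k - x_term v k\<bar> = 2 * h"
      using S_pos[of k] by (simp add: x_term_def j_def h_def diff_divide_distrib[symmetric])
    ultimately have "h \<le> \<bar>x_val u - x_val v\<bar>" by linarith
    then show ?thesis by (simp add: h_def)
  qed
  have "j / (2 * real (M k)) / R \<le> (j / (2 * real (M k))) powr (1 / \<alpha>) / R"
  proof (rule divide_right_mono)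
    have "(j / (2 * real (M k))) powr 1 \<le> (j / (2 * real (M k))) powr (1 / \<alpha>)"
      using \<alpha> j1 jM Mk by (intro powr_mono') (auto simp: field_simps)
    then show "j / (2 * real (M k)) \<le> (j / (2 * real (M k))) powr (1 / \<alpha>)" using j1 Mk by simp
  qed (use R in simp)
  also have "\<dots> = (j / (2 * (real (M k) * S k))) powr (1 / \<alpha>)"
  proof -
    have split: "j / (2 * (real (M k) * S k)) = (j / (2 * real (M k))) / S k" by simp
    have root: "S k powr (1 / \<alpha>) = R" using \<alpha> R by (simp add: S_def R_def powr_powr)
    show ?thesis by (simp only: split powr_divide root)
  qed
  also have "\<dots> \<le> \<bar>x_val u - x_val v\<bar> powr (1 / \<alpha>)"
    using x \<alpha> j1 Mk S_pos[of k] by (intro powr_mono2) auto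
  finally have hoelder: "j / (2 * real (M k)) / R \<le> \<bar>x_val u - x_val v\<bar> powr (1 / \<alpha>)" .
  note y
  also have "3 * j / (R * real (M k)) = 6 * (j / (2 * real (M k)) / R)" by (simp add: field_simps)
  also have "\<dots> \<le> 6 * \<bar>x_val u - x_val v\<bar> powr (1 / \<alpha>)" using hoelder by (rule mult_left_mono) simp
  finally show ?thesis .
qed simp

text \<open>
  The Hoelder map carries a cover by balls of radii \<open>r i\<close> to a cover of the unit interval by intervals of radii
  \<open>12 * r i powr s\<close>, whose total length is at least \<open>1\<close>.
\<close>

lemma not_hausdorff_null_x_val_image:
  assumes s: "0 < s" "s \<le> 1 / \<alpha>"
  shows "\<not> hausdorff_null s (x_val ` \<Omega>)"
proof
  assume "hausdorff_null s (x_val ` \<Omega>)"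
  then obtain c r where cr: "\<And>i::nat. 0 < r i" "\<And>i. r i < 1" "x_val ` \<Omega> \<subseteq> (\<Union>i. ball (c i) (r i))"
    "(\<Sum>i. ennreal (r i powr s)) < ennreal (1/48)"
    by (rule hausdorff_nullE[of s _ "1/48" 1]) (use s in \<open>auto intro: that\<close>)
  \<comment> \<open>When no digit sequence has its value in the \<open>i\<close>-th ball, the choice is arbitrary and the interval merely superfluous.\<close>
  define w where "w i = (SOME u. u \<in> \<Omega> \<and> x_val u \<in> ball (c i) (r i))" for i
  define z where "z i = y_val (w i)" for i
  have cov: "{0..<1} \<subseteq> (\<Union>i. cball (z i) (12 * r i powr s))"
  proof
    fix t :: real assume "t \<in> {0..<1}"
    then obtain u where u: "u \<in> \<Omega>" "(\<lambda>i. real (u i) / real (radix M (Suc i))) sums t"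
      using mixed_radix_expansion[of M t] M_ge2 by auto
    have t: "y_val u = t" using u(2) by (simp add: y_val_def y_term_def[abs_def] sums_iff)
    obtain i where i: "x_val u \<in> ball (c i) (r i)" using cr(3) u(1) by blast
    define v where "v = w i"
    have v: "v \<in> \<Omega>" "x_val v \<in> ball (c i) (r i)"
      unfolding v_def w_def using someI[of "\<lambda>u. u \<in> \<Omega> \<and> x_val u \<in> ball (c i) (r i)" u] u(1) i by auto
    have "\<bar>x_val v - x_val u\<bar> \<le> 2 * r i" using i v(2) by (simp add: dist_real_def)
    then have "\<bar>x_val v - x_val u\<bar> powr (1/\<alpha>) \<le> (2 * r i) powr (1/\<alpha>)" using \<alpha> by (intro powr_mono2) auto
    also have "\<dots> = 2 powr (1/\<alpha>) * r i powr (1/\<alpha>)" using cr(1)[of i] by (simp add: powr_mult)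
    also have "\<dots> \<le> 2 powr 1 * r i powr s"
      using \<alpha> s cr(1,2)[of i] by (intro mult_mono powr_mono powr_mono') (auto intro: less_imp_le)
    finally have "\<bar>y_val v - y_val u\<bar> \<le> 12 * r i powr s" using y_hoelder_x[OF v(1) u(1)] by simp
    then have "t \<in> cball (z i) (12 * r i powr s)" by (simp add: t z_def v_def dist_real_def)
    then show "t \<in> (\<Union>i. cball (z i) (12 * r i powr s))" by blast
  qed
  have "1 = emeasure lborel {0..<1::real}" by simp
  also have "\<dots> \<le> emeasure lborel (\<Union>i. cball (z i) (12 * r i powr s))"
    using cov by (intro emeasure_mono) auto
  also have "\<dots> \<le> (\<Sum>i. emeasure lborel (cball (z i) (12 * r i powr s)))"
    by (intro emeasure_subadditive_countably) auto
  also have "\<dots> = (\<Sum>i. ennreal (24 * r i powr s))" by (simp add: cball_eq_atLeastAtMost)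
  also have "\<dots> = (\<Sum>i. ennreal 24 * ennreal (r i powr s))" by (intro suminf_cong ennreal_mult) auto
  also have "\<dots> = ennreal 24 * (\<Sum>i. ennreal (r i powr s))" by (rule ennreal_suminf_cmult)
  also have "\<dots> \<le> ennreal 24 * ennreal (1/48)" using cr(4) by (intro mult_left_mono) auto
  also have "\<dots> = ennreal (24 * (1/48))" by (rule ennreal_mult[symmetric]) auto
  also have "\<dots> < ennreal 1" by (intro ennreal_lessI) auto
  finally show False by simp
qed

text \<open>
  The union over \<open>m\<close> is the group generated by the values of \<open>x_val\<close>. No rational span is taken at this point,
  so that the last digits of an element stay in one lattice.
\<close>

fun differences :: "nat \<Rightarrow> real set" where
  "differences 0 = {0}"
| "differences (Suc m) = {e + p | e p. e \<in> differences m \<and>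
     p \<in> {a - b | a b. a \<in> x_val ` \<Omega> \<and> b \<in> x_val ` \<Omega>}}"

lemma compact_x_val_image: "compact (x_val ` \<Omega>)"
proof -
  have "continuous_on \<Omega> x_val" unfolding x_val_def[abs_def]
  proof (rule continuous_on_suminf)
    show "continuous_on \<Omega> (\<lambda>u. x_term u k)" for k
      by (rule continuous_on_finite_dependence[of _ "Suc k"]) (simp add: x_term_def)
    show "\<bar>x_term u k\<bar> \<le> 1 / S k" if "u \<in> \<Omega>" for u k using x_term_bounds[OF that, of k] by simp
    show "summable (\<lambda>k. 1 / S k)"
      by (rule geometric_tail(1)[where q = S]) (use S_pos S_doubles in \<open>auto simp: less_imp_le\<close>)
  qed
  then show ?thesis by (rule compact_continuous_image) (rule compact_digit_seqs)
qed

lemma compact_differences_m: "compact (differences m)"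
proof (induction m)
  case (Suc m)
  show ?case unfolding differences.simps
    by (intro compact_sums compact_differences compact_x_val_image Suc)
qed simp

lemma add_subgroup_differences: "add_subgroup (\<Union>m. differences m)"
  unfolding add_subgroup_def
proof (intro conjI ballI)
  show "0 \<in> (\<Union>m. differences m)" by (rule UN_I[of 0]) auto
next
  fix x y assume "x \<in> (\<Union>m. differences m)" "y \<in> (\<Union>m. differences m)"
  then obtain m n where "x \<in> differences m" "y \<in> differences n" by blast
  then have "x + y \<in> differences (m + n)"
  proof (induction n arbitrary: y)
    case (Suc n)
    from Suc.prems(2) obtain e p where ep: "y = e + p" "e \<in> differences n"
      "p \<in> {a - b | a b. a \<in> x_val ` \<Omega> \<and> b \<in> x_val ` \<Omega>}" unfolding differences.simps by blast
    have "x + e \<in> differences (m + n)" using Suc.IH Suc.prems(1) ep(2) by blast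
    moreover have "x + y = (x + e) + p" using ep(1) by simp
    ultimately show ?case using ep(3) unfolding add_Suc_right differences.simps by blast
  qed simp
  then show "x + y \<in> (\<Union>m. differences m)" by blast
next
  fix x assume "x \<in> (\<Union>m. differences m)"
  then obtain m where "x \<in> differences m" by blast
  then have "- x \<in> differences m"
  proof (induction m arbitrary: x)
    case (Suc m)
    then obtain e a b where e: "x = e + (a - b)" "e \<in> differences m" "a \<in> x_val ` \<Omega>" "b \<in> x_val ` \<Omega>"
      unfolding differences.simps by blast
    have "- x = - e + (b - a)" using e(1) by simp
    then show ?case using Suc.IH[OF e(2)] e(3,4) unfolding differences.simps by blast
  qed simp
  then show "- x \<in> (\<Union>m. differences m)" by blast
qed

lemma x_val_image_subset: "x_val ` \<Omega> \<subseteq> (\<Union>m. differences m)"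
proof
  fix a assume a: "a \<in> x_val ` \<Omega>"
  have "(\<lambda>_. 0) \<in> \<Omega>" using M_pos by (simp add: digit_seqs_def)
  moreover have "x_val (\<lambda>_. 0) = 0" by (simp add: x_val_def x_term_def)
  ultimately have z: "0 \<in> x_val ` \<Omega>" by (metis image_eqI)
  have "a = 0 + (a - 0)" by simp
  then have "a \<in> differences (Suc 0)" using a z unfolding differences.simps by blast
  then show "a \<in> (\<Union>m. differences m)" by blast
qed

text \<open>
  Counting \<open>radix M k ^ (2 * m) * M k ^ (2 * m)\<close> points would be too generous. The \<open>k\<close>-th digits of the \<open>2 * m\<close> summands
  only enter through their signed sum, an integer of size at most \<open>m * M k\<close>.
\<close>

lemma differences_near_grid:
  obtains H where "finite H" "card H \<le> radix M k ^ (2 * m)"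
    "\<And>x. x \<in> differences m \<Longrightarrow> \<exists>h\<in>H. \<exists>z::int. \<bar>z\<bar> \<le> int (m * M k) \<and>
       \<bar>x - (h + of_int z / (real (M k) * S k))\<bar> \<le> 4 * real m / S (Suc k)"
proof -
  define F where "F = (\<lambda>u. \<Sum>i<k. x_term u i) ` \<Omega>"
  have F: "finite F" "card F \<le> radix M k"
    unfolding F_def
    by (rule finite_prefix_values[OF subset_refl, where k = k], simp add: x_term_def)+
  have "\<exists>H. finite H \<and> card H \<le> radix M k ^ (2 * m) \<and>
    (\<forall>x\<in>differences m. \<exists>h\<in>H. \<exists>z::int. \<bar>z\<bar> \<le> int (m * M k) \<and>
       \<bar>x - (h + of_int z / (real (M k) * S k))\<bar> \<le> 4 * real m / S (Suc k))"
  proof (induction m)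
    case 0
    show ?case by (intro exI[of _ "{0}"]) auto
  next
    case (Suc m)
    then obtain H where H: "finite H" "card H \<le> radix M k ^ (2 * m)"
      "\<And>x. x \<in> differences m \<Longrightarrow> \<exists>h\<in>H. \<exists>z::int. \<bar>z\<bar> \<le> int (m * M k) \<and>
       \<bar>x - (h + of_int z / (real (M k) * S k))\<bar> \<le> 4 * real m / S (Suc k)" by blast
    define H' where "H' = (\<lambda>(h, f, g). h + (f - g)) ` (H \<times> F \<times> F)"
    have "card H' \<le> card (H \<times> F \<times> F)" unfolding H'_def using H F by (intro card_image_le) auto
    also have "\<dots> \<le> radix M k ^ (2 * m) * (radix M k * radix M k)"
      using H F by (simp add: card_cartesian_product mult_le_mono)
    finally have card: "card H' \<le> radix M k ^ (2 * Suc m)" by (simp add: algebra_simps)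
    have "\<exists>h\<in>H'. \<exists>z::int. \<bar>z\<bar> \<le> int (Suc m * M k) \<and>
       \<bar>x - (h + of_int z / (real (M k) * S k))\<bar> \<le> 4 * real (Suc m) / S (Suc k)"
      if "x \<in> differences (Suc m)" for x
    proof -
      obtain e u v where x: "x = e + (x_val u - x_val v)" "e \<in> differences m" "u \<in> \<Omega>" "v \<in> \<Omega>"
        using \<open>x \<in> differences (Suc m)\<close> unfolding differences.simps by blast
      obtain h z where hz: "h \<in> H" "\<bar>z\<bar> \<le> int (m * M k)"
        "\<bar>e - (h + of_int z / (real (M k) * S k))\<bar> \<le> 4 * real m / S (Suc k)" using H(3)[OF x(2)] by blast
      define z' where "z' = z + (int (u k) - int (v k))"
      have "\<bar>z'\<bar> \<le> int (m * M k) + int (M k)"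
        using hz(2) digit_seqs_less[OF x(3), of k] digit_seqs_less[OF x(4), of k] by (simp add: z'_def)
      then have z': "\<bar>z'\<bar> \<le> int (Suc m * M k)" by simp
      define f where "f = (\<Sum>i<k. x_term u i)"
      define g where "g = (\<Sum>i<k. x_term v i)"
      have "h + (f - g) \<in> H'" unfolding H'_def F_def f_def g_def using hz(1) x(3,4) by force
      moreover have "\<bar>x - ((h + (f - g)) + of_int z' / (real (M k) * S k))\<bar> \<le> 4 * real (Suc m) / S (Suc k)"
      proof -
        have "\<bar>x_val u - (f + x_term u k)\<bar> \<le> 2 / S (Suc k)" "\<bar>x_val v - (g + x_term v k)\<bar> \<le> 2 / S (Suc k)"
          using x_val_tail[OF x(3), of k] x_val_tail[OF x(4), of k] by (simp_all add: f_def g_def)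
        moreover have "of_int z' / (real (M k) * S k) = of_int z / (real (M k) * S k) + (x_term u k - x_term v k)"
          by (simp add: z'_def x_term_def add_divide_distrib diff_divide_distrib)
        ultimately have "\<bar>x - ((h + (f - g)) + of_int z' / (real (M k) * S k))\<bar>
            \<le> 4 * real m / S (Suc k) + (2 / S (Suc k) + 2 / S (Suc k))"
          using hz(3) x(1) unfolding abs_le_iff by linarith
        also have "\<dots> = 4 * real (Suc m) / S (Suc k)"
          by (simp add: add_divide_distrib[symmetric] algebra_simps)
        finally show ?thesis .
      qed
      ultimately show ?thesis using z' by blast
    qed
    then show ?case using card H(1) F(1) by (intro exI[of _ H']) (auto simp: H'_def)
  qed
  then show ?thesis using that by blast
qed

text \<open>
  Write \<open>\<alpha> * t = 1 + \<eta>\<close> with \<open>\<eta> > 0\<close>. There are about \<open>radix M k ^ (2 * m) * M k\<close> balls of radius about \<open>1 / S (k+1)\<close>, and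
  \<open>S (k+1) powr t\<close> is at least \<open>M k powr (1 + \<eta>)\<close>. The surplus \<open>M k powr \<eta>\<close> beats any fixed power of \<open>radix M k\<close>
  by the growth condition.
\<close>

lemma hausdorff_null_differences:
  assumes t: "1 / \<alpha> < t"
  shows "hausdorff_null t (differences m)"
proof (rule hausdorff_null_finite_cover)
  show t0: "0 < t" using \<alpha> t by (meson divide_pos_pos less_trans zero_less_one)
  define \<eta> where "\<eta> = \<alpha> * t - 1"
  have \<eta>: "0 < \<eta>" using t \<alpha> by (simp add: \<eta>_def field_simps)
  fix \<epsilon> :: real assume e: "0 < \<epsilon>"
  define C where "C = (2 * real m + 1) * (4 * real m + 1) powr t"
  have C: "0 < C" by (simp add: C_def)
  obtain k :: nat where k: "max 1 (max ((2 * real m + 1) / \<eta>) (C / \<epsilon>)) < real k" using reals_Archimedean2 by blast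
  then have k1: "1 \<le> real k" "(2 * real m + 1) / \<eta> < real k" "C / \<epsilon> < real k" by auto
  obtain H where H: "finite H" "card H \<le> radix M k ^ (2 * m)"
    "\<And>x. x \<in> differences m \<Longrightarrow> \<exists>h\<in>H. \<exists>z::int. \<bar>z\<bar> \<le> int (m * M k) \<and>
       \<bar>x - (h + of_int z / (real (M k) * S k))\<bar> \<le> 4 * real m / S (Suc k)"
    using differences_near_grid by blast
  define Z where "Z = {- int (m * M k)..int (m * M k)}"
  \<comment> \<open>The summand \<open>1\<close> makes the inclusion in open balls strict, and the radius positive for \<open>m = 0\<close>.\<close>
  define \<rho> where "\<rho> = (4 * real m + 1) / S (Suc k)"
  have \<rho>: "0 < \<rho>" using S_pos by (simp add: \<rho>_def)
  define c where "c = (\<lambda>(h, z::int). h + of_int z / (real (M k) * S k))"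
  define R where "R = real (radix M k)"
  have R: "1 \<le> R" using radix_M_pos[of k] by (simp add: R_def)
  have Mk: "1 \<le> real (M k)" using M_pos[of k] by simp
  have "finite (H \<times> Z)" using H(1) by (simp add: Z_def)
  moreover have "differences m \<subseteq> (\<Union>p\<in>H \<times> Z. ball (c p) \<rho>)"
  proof
    fix x assume "x \<in> differences m"
    then obtain h z where hz: "h \<in> H" "\<bar>z\<bar> \<le> int (m * M k)"
       "\<bar>x - (h + of_int z / (real (M k) * S k))\<bar> \<le> 4 * real m / S (Suc k)" using H(3) by blast
    have "4 * real m / S (Suc k) < \<rho>" unfolding \<rho>_def using S_pos by (intro divide_strict_right_mono) auto
    then have "x \<in> ball (c (h, z)) \<rho>" using hz(3) by (simp add: c_def dist_real_def abs_minus_commute)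
    moreover have "(h, z) \<in> H \<times> Z" using hz(1,2) by (auto simp: Z_def)
    ultimately show "x \<in> (\<Union>p\<in>H \<times> Z. ball (c p) \<rho>)" by blast
  qed
  moreover have "(\<Sum>p\<in>H \<times> Z. \<rho> powr t) < \<epsilon>"
  proof -
    have cH: "real (card H) \<le> R ^ (2 * m)" using H(2) by (simp add: R_def flip: of_nat_power)
    have cZ: "real (card Z) \<le> (2 * real m + 1) * real (M k)"
      using Mk by (simp add: Z_def algebra_simps)
    have S: "S (Suc k) powr t = (R * real (M k)) powr (1 + \<eta>)"
      by (simp add: S_def R_def radix_Suc powr_powr \<eta>_def)
    have "R ^ (2 * m) * R = R powr (2 * real m + 1)"
      using R by (simp add: powr_add powr_realpow[symmetric])
    also have "\<dots> \<le> R powr (real (k * k) * \<eta>)"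
    proof (rule powr_mono)
      have "2 * real m + 1 \<le> real k * \<eta>" using k1(2) \<eta> by (simp add: field_simps)
      also have "\<dots> \<le> real (k * k) * \<eta>" using k1(1) \<eta> by (intro mult_right_mono) (auto simp: mult_le_cancel_left1)
      finally show "2 * real m + 1 \<le> real (k * k) * \<eta>" .
    qed (rule R)
    also have "\<dots> = (R ^ (k * k)) powr \<eta>" using R by (simp add: powr_powr powr_realpow[symmetric])
    also have "\<dots> \<le> real (M k) powr \<eta>"
    proof (rule powr_mono2)
      show "R ^ (k * k) \<le> real (M k)" using M_growth[of k] unfolding R_def by (metis of_nat_le_iff of_nat_power)
    qed (use \<eta> R in auto)
    also have "real (M k) powr \<eta> = real (M k) powr (1 + \<eta>) / real (M k)" using Mk by (simp add: powr_add)
    also have "\<dots> \<le> S (Suc k) powr t / real (M k)"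
    proof (rule divide_right_mono)
      have "1 * real (M k) \<le> R * real (M k)" using R by (intro mult_right_mono) auto
      then show "real (M k) powr (1 + \<eta>) \<le> S (Suc k) powr t" unfolding S using \<eta> by (intro powr_mono2) auto
    qed simp
    finally have key: "R ^ (2 * m) * R * real (M k) \<le> S (Suc k) powr t" using Mk by (simp add: field_simps)
    have Spos: "0 < S (Suc k) powr t" using S_pos[of "Suc k"] by simp
    have "(\<Sum>p\<in>H \<times> Z. \<rho> powr t) = real (card H) * real (card Z) * \<rho> powr t"
      by (simp add: card_cartesian_product)
    also have "\<dots> \<le> R ^ (2 * m) * ((2 * real m + 1) * real (M k)) * \<rho> powr t"
      using cH cZ by (intro mult_right_mono mult_mono) auto
    also have "\<dots> = C * ((R ^ (2 * m) * real (M k)) / S (Suc k) powr t)"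
      using S_pos[of "Suc k"] by (simp add: C_def \<rho>_def powr_divide less_imp_le)
    also have "\<dots> \<le> C * (1 / R)"
    proof (rule mult_left_mono)
      show "(R ^ (2 * m) * real (M k)) / S (Suc k) powr t \<le> 1 / R"
        using key R Spos by (simp add: field_simps)
    qed (use C in simp)
    also have "\<dots> < \<epsilon>"
    proof -
      have "real k < 2 ^ k" by (rule of_nat_less_two_power)
      also have "(2::real) ^ k \<le> R"
        using radix_ge_power2[of M k] M_ge2 unfolding R_def by (metis of_nat_le_iff of_nat_numeral of_nat_power)
      finally have "C / \<epsilon> < R" using k1(3) by linarith
      then show ?thesis using e R by (simp add: field_simps)
    qed
    finally show ?thesis .
  qed
  ultimately show "\<exists>(I::(real \<times> int) set) c r. finite I \<and> (\<forall>i\<in>I. 0 < r i) \<and>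
      differences m \<subseteq> (\<Union>i\<in>I. ball (c i) (r i)) \<and> (\<Sum>i\<in>I. r i powr t) < \<epsilon>"
    using \<rho> by (intro exI[of _ "H \<times> Z"] exI[of _ c] exI[of _ "\<lambda>_. \<rho>"]) auto
qed

lemma subgroup_of_dimension:
  "fsigma (\<Union>m. differences m)" "hausdorff_dim (\<Union>m. differences m) = ennreal (1 / \<alpha>)"
proof -
  let ?G = "\<Union>m. differences m"
  show "fsigma ?G" by (intro fsigma_UN_compact compact_differences_m)
  have d0: "0 < 1 / \<alpha>" using \<alpha> by simp
  have le: "hausdorff_dim ?G \<le> ennreal (1 / \<alpha>)"
    using hausdorff_dim_le_iff[of "1 / \<alpha>" ?G] d0 hausdorff_null_differences hausdorff_null_UN[of _ differences] by simp
  moreover have "\<not> hausdorff_dim ?G < ennreal (1 / \<alpha>)"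
  proof
    assume less: "hausdorff_dim ?G < ennreal (1 / \<alpha>)"
    show False
    proof (cases "hausdorff_dim ?G")
      case (real s)
      then have s: "s < 1 / \<alpha>" using less by (simp add: ennreal_less_iff)
      define s' where "s' = (s + 1 / \<alpha>) / 2"
      have s': "s < s'" "s' \<le> 1 / \<alpha>" using s by (auto simp: s'_def field_simps)
      have "hausdorff_null s' ?G" using hausdorff_dim_le_iff[of s ?G] real s'(1) by simp
      then have "hausdorff_null s' (x_val ` \<Omega>)" using x_val_image_subset by (rule hausdorff_null_subset)
      then show False using not_hausdorff_null_x_val_image[of s'] s' real by simp
    qed (use less in auto)
  qed
  ultimately show "hausdorff_dim ?G = ennreal (1 / \<alpha>)" by simp
qed

end

text \<open>
  The sequence of products of the radices. The summand \<open>m\<close> keeps every radix above the threshold needed for the gap, and the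
  exponent \<open>k * k + 1\<close> provides the growth.
\<close>

fun scale_growth :: "nat \<Rightarrow> nat \<Rightarrow> nat" where
  "scale_growth m 0 = 1"
| "scale_growth m (Suc k) = scale_growth m k * (scale_growth m k + m) ^ (k * k + 1)"

lemma exists_subgroup_of_positive_dimension:
  assumes d: "0 < d" "d < 1"
  obtains B :: "real set" where "fsigma B" "add_subgroup B" "hausdorff_dim B = ennreal d"
proof -
  define \<alpha> where "\<alpha> = 1 / d"
  have \<alpha>: "1 < \<alpha>" using d by (simp add: \<alpha>_def)
  obtain m :: nat where m: "max 2 (4 powr (1 / (\<alpha> - 1))) < real m" using reals_Archimedean2 by blast
  define M where "M k = (scale_growth m k + m) ^ (k * k + 1)" for k
  have R: "radix M k = scale_growth m k" for k by (induction k) (simp_all add: radix_Suc M_def)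
  have Mm: "m \<le> M k" for k
  proof -
    have "m \<le> scale_growth m k + m" by simp
    also have "\<dots> \<le> (scale_growth m k + m) ^ (k * k + 1)" using m by (intro self_le_power) auto
    finally show ?thesis by (simp add: M_def)
  qed
  interpret sparse_digits \<alpha> M
  proof
    show "2 \<le> M k" for k using Mm[of k] m by simp
    show "4 \<le> real (M k) powr (\<alpha> - 1)" for k
    proof -
      have "4 = (4 powr (1 / (\<alpha> - 1))) powr (\<alpha> - 1)" using \<alpha> by (simp add: powr_powr)
      also have "\<dots> \<le> real (M k) powr (\<alpha> - 1)" using \<alpha> m Mm[of k] by (intro powr_mono2) auto
      finally show ?thesis .
    qed
    show "radix M k ^ (k * k) \<le> M k" for k
    proof -
      have "radix M k ^ (k * k) \<le> (scale_growth m k + m) ^ (k * k)" unfolding R by (intro power_mono) auto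
      also have "\<dots> \<le> M k" unfolding M_def using m by (intro power_increasing) auto
      finally show ?thesis .
    qed
  qed (rule \<alpha>)
  show ?thesis
    using that[OF subgroup_of_dimension(1) add_subgroup_differences] subgroup_of_dimension(2) d
    by (simp add: \<alpha>_def)
qed

lemma exists_subgroup_of_dimension:
  assumes d: "0 \<le> d" "d < 1"
  obtains B :: "real set" where "fsigma B" "add_subgroup B" "hausdorff_dim B = ennreal d"
proof (cases "d = 0")
  case True
  have "hausdorff_null t {0}" if t: "0 < t" for t
  proof (rule hausdorff_null_finite_cover[OF t])
    fix \<epsilon> :: real assume "0 < \<epsilon>"
    then show "\<exists>(I::unit set) c r. finite I \<and> (\<forall>i\<in>I. 0 < r i) \<and>
        {0} \<subseteq> (\<Union>i\<in>I. ball (c i) (r i)) \<and> (\<Sum>i\<in>I. r i powr t) < \<epsilon>"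
      using t by (intro exI[of _ UNIV] exI[of _ "\<lambda>_. 0"] exI[of _ "\<lambda>_. (\<epsilon>/2) powr (1/t)"])
        (simp add: powr_powr)
  qed
  then have "hausdorff_dim {0::real} \<le> ennreal 0" by (simp only: hausdorff_dim_le_iff order_refl) simp
  moreover have "fsigma {0::real}" using fsigma_UN_compact[of "\<lambda>_::unit. {0}"] by simp
  moreover have "add_subgroup {0::real}" by (simp add: add_subgroup_def)
  ultimately show ?thesis using that[of "{0}"] True by simp
next
  case False
  show ?thesis by (rule exists_subgroup_of_positive_dimension[of d]) (use d False in \<open>auto intro: that\<close>)
qed

section \<open>The theorem\<close>

theorem corollary2p3:
  shows "(\<forall>(B :: real set) (D :: real set).
            fsigma B \<and> add_subgroup B \<and> countable D \<and> D \<subseteq> UNIV - \<rat> \<longrightarrow>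
            (\<exists>A :: real set. fsigma A \<and> rat_real.subspace A \<and> B \<subseteq> A \<and>
                hausdorff_dim A = hausdorff_dim B \<and> D \<subseteq> X_set A))
       \<and> (\<forall>(d :: real) (D :: real set).
            0 \<le> d \<and> d < 1 \<and> countable D \<and> D \<subseteq> UNIV - \<rat> \<longrightarrow>
            (\<exists>A :: real set. fsigma A \<and> rat_real.subspace A \<and>
                hausdorff_dim A = ennreal d \<and> D \<subseteq> X_set A))"
proof (intro conjI allI impI)
  fix B D :: "real set"
  assume "fsigma B \<and> add_subgroup B \<and> countable D \<and> D \<subseteq> UNIV - \<rat>"
  then obtain A where "fsigma A" "rat_real.subspace A" "B \<subseteq> A" "hausdorff_dim A = hausdorff_dim B" "D \<subseteq> X_set A"
    using subgroup_extension[of B D] by auto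
  then show "\<exists>A. fsigma A \<and> rat_real.subspace A \<and> B \<subseteq> A \<and> hausdorff_dim A = hausdorff_dim B \<and> D \<subseteq> X_set A"
    by blast
next
  fix d :: real and D :: "real set"
  assume dD: "0 \<le> d \<and> d < 1 \<and> countable D \<and> D \<subseteq> UNIV - \<rat>"
  obtain B :: "real set" where B: "fsigma B" "add_subgroup B" "hausdorff_dim B = ennreal d"
    using exists_subgroup_of_dimension[of d] dD by auto
  obtain A where "fsigma A" "rat_real.subspace A" "B \<subseteq> A" "hausdorff_dim A = hausdorff_dim B" "D \<subseteq> X_set A"
    using subgroup_extension[OF B(1,2), of D] dD by blast
  then show "\<exists>A. fsigma A \<and> rat_real.subspace A \<and> hausdorff_dim A = ennreal d \<and> D \<subseteq> X_set A"
    using B(3) by auto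
qed

end
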